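(* Let $\mathcal F\subseteq\mathcal P(\omega)$ be a non-principal $\Delta^1_1$ filter. Then, for any $f\colon\omega\to\omega$, $$f\leq_{\mathrm{LT}}\mathcal F\iff f\text{ is hyperarithmetic}.$$
   Context: **Filters.** An upper set is a nonempty family $\mathcal U\subseteq\mathcal P(\omega)$, closed upwards under $\subseteq$, with $\emptyset\notin\mathcal U$. A filter is an upper set closed under finite intersections. A filter $\mathcal F$ is principal if there exists some $S\subseteq\omega$ such that $\mathcal F=\{A\subseteq\omega : S\subseteq A\}$; otherwise it is non-principal. The filter $\mathcal F$ is $\Delta^1_1$ if, as a subset of $\mathcal P(\omega)\cong2^\omega$, it is (lightface) $\Delta^1_1$, i.e. both $\Sigma^1_1$ and $\Pi^1_1$. **Hyperarithmetic.** A set $A\subseteq\omega$ is $\Pi^1_1$ if it can be defined in the language of second-order arithmetic by $A=\{x:\forall X\,\psi(X,x)\}$, where $\forall X$ is the only second-order quantifier (ranging over subsets of $\omega$) in the formula; it is $\Sigma^1_1$ if its complement is $\Pi^1_1$, and $\Delta^1_1$ (hyperarithmetic) if it is both. A function $f\colon\omega\to\omega$ is hyperarithmetic if $\{\langle n,f(n)\rangle:n\in\omega\}$ is a hyperarithmetic set, for a fixed computable bijection $\langle-,-\rangle\colon\omega^2\to\omega$. **Upper sequences.** An upper sequence is a family $\overline{\mathcal U}=(\mathcal U_n)_{n\in I}$ of upper sets with $I\subseteq\omega$. An upper set is viewed as an upper sequence with a singleton index set (equivalently, as the constant sequence). A function $f\colon\omega\to\omega$ is viewed as the upper sequence whose $n$-th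 term is the principal ultrafilter $\{A\subseteq\omega:f(n)\in A\}$. **LT-game and $\leq_{\mathrm{LT}}$.** For upper sequences $\overline{\mathcal U}=(\mathcal U_i)_{i\in I}$, $\overline{\mathcal V}=(\mathcal V_j)_{j\in J}$, the game $\mathfrak G(\overline{\mathcal U},\overline{\mathcal V})$ is played by Merlin against the team Arthur–Nimue. Merlin first chooses $x_0\in I$ and $A\in\mathcal U_{x_0}$. At round $n=0,1,\dots$ Arthur plays either $\langle1,u_n\rangle$, terminating the game with output $u_n$, or $\langle0,u_n\rangle$ with $u_n\in J$ (a query); after a query Nimue chooses $B_n\in\mathcal V_{u_n}$ and Merlin replies with $x_{n+1}\in B_n$. Arthur sees only $x_0,\dots,x_n$, and his strategy is a partial computable function from finite strings of natural numbers to $\omega$; Nimue sees the whole history and her strategy is arbitrary. The Arthur–Nimue strategy wins if every play following it terminates legally (after finitely many rounds) with output in $A$, or Merlin violates the rules before Arthur and Nimue do. $\overline{\mathcal U}\leq_{\mathrm{LT}}\overline{\mathcal V}$ holds iff Arthur–Nimue have a winning strategy in $\mathfrak G(\overline{\mathcal U},\overline{\mathcal V})$.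
   Formalization: The filter is additionally assumed to have empty intersection; otherwise the claim fails: for the non-principal filter of cofinite sets containing 0, Merlin can always reply 0, so only computable f are LT-below it. *)

theory Defs
  imports Main "HOL-Library.Nat_Bijection"
begin

section \<open>Partial computable functions\<close>

datatype recf =
    Zero
  | Succ
  | Proj nat
  | Comp recf "recf list"
  | PrimRec recf recf
  | Mu recf

text \<open>
  Kleene's schemes, read on argument lists without arity bookkeeping: a scheme applied to a list that
  is too short is undefined. Restricted to lists of any fixed length, the functions denoted are
  exactly the partial recursive ones of that arity. \<^const>\<open>those\<close> makes composition strict, and the
  minimisation requires the values at all smaller arguments to be defined and nonzero.
\<close>

fun recf_eval :: "recf \<Rightarrow> nat list \<Rightarrow> nat option" where
  "recf_eval Zero xs = Some 0"
| "recf_eval Succ xs = (case xs of [] \<Rightarrow> None | x # _ \<Rightarrow> Some (Suc x))"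
| "recf_eval (Proj i) xs = (if i < length xs then Some (xs ! i) else None)"
| "recf_eval (Comp f gs) xs =
     (case those (map (\<lambda>g. recf_eval g xs) gs) of None \<Rightarrow> None | Some ys \<Rightarrow> recf_eval f ys)"
| "recf_eval (PrimRec f g) xs =
     (case xs of [] \<Rightarrow> None
      | n # ys \<Rightarrow> rec_nat (recf_eval f ys)
          (\<lambda>k r. case r of None \<Rightarrow> None | Some y \<Rightarrow> recf_eval g (k # y # ys)) n)"
| "recf_eval (Mu f) xs =
     (if \<exists>n. recf_eval f (n # xs) = Some 0 \<and> (\<forall>m<n. \<exists>y. recf_eval f (m # xs) = Some (Suc y))
      then Some (LEAST n. recf_eval f (n # xs) = Some 0) else None)"

text \<open>
  Finite strings are represented by their codes under the computable bijection
  \<^const>\<open>list_encode\<close>.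
\<close>

definition partial_computable_on_strings :: "(nat list \<Rightarrow> nat option) \<Rightarrow> bool" where
  "partial_computable_on_strings \<phi> \<longleftrightarrow> (\<exists>r. \<forall>\<sigma>. \<phi> \<sigma> = recf_eval r [list_encode \<sigma>])"


section \<open>The lightface analytical classes\<close>

datatype arith_term =
    Var nat
  | Zer
  | One
  | Plus arith_term arith_term
  | Times arith_term arith_term

text \<open>
  Arithmetical formulas of second-order arithmetic, i.e. those without second-order quantifiers.
  In \<^term>\<open>In t X\<close> the second argument is (the index of) a set variable.
\<close>

datatype arith_formula =
    Eq arith_term arith_term
  | Less arith_term arith_term
  | In arith_term nat
  | Neg arith_formula
  | Conj arith_formula arith_formula
  | Forall nat arith_formula

primrec term_val :: "(nat \<Rightarrow> nat) \<Rightarrow> arith_term \<Rightarrow> nat" where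
  "term_val e (Var i) = e i"
| "term_val e Zer = 0"
| "term_val e One = 1"
| "term_val e (Plus s t) = term_val e s + term_val e t"
| "term_val e (Times s t) = term_val e s * term_val e t"

primrec sat :: "(nat \<Rightarrow> nat) \<Rightarrow> (nat \<Rightarrow> nat set) \<Rightarrow> arith_formula \<Rightarrow> bool" where
  "sat e E (Eq s t) \<longleftrightarrow> term_val e s = term_val e t"
| "sat e E (Less s t) \<longleftrightarrow> term_val e s < term_val e t"
| "sat e E (In t i) \<longleftrightarrow> term_val e t \<in> E i"
| "sat e E (Neg p) \<longleftrightarrow> \<not> sat e E p"
| "sat e E (Conj p q) \<longleftrightarrow> sat e E p \<and> sat e E q"
| "sat e E (Forall i p) \<longleftrightarrow> (\<forall>n. sat (e(i := n)) E p)"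

text \<open>
  Set variable 0 is the universally quantified one. The argument is number variable 0 for sets of
  numbers, and set variable 1 for families of sets. Any further free variable denotes 0 or the empty
  set, so no parameters enter.
\<close>

definition Pi11_set :: "nat set \<Rightarrow> bool" where
  "Pi11_set A \<longleftrightarrow> (\<exists>\<psi>. A = {x. \<forall>X. sat ((\<lambda>_. 0)(0 := x)) ((\<lambda>_. {})(0 := X)) \<psi>})"

definition Sigma11_set :: "nat set \<Rightarrow> bool" where
  "Sigma11_set A \<longleftrightarrow> Pi11_set (- A)"

definition hyperarithmetic_set :: "nat set \<Rightarrow> bool" where
  "hyperarithmetic_set A \<longleftrightarrow> Sigma11_set A \<and> Pi11_set A"

definition hyperarithmetic :: "(nat \<Rightarrow> nat) \<Rightarrow> bool" where
  "hyperarithmetic f \<longleftrightarrow> hyperarithmetic_set {prod_encode (n, f n) |n. True}"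

definition Pi11_family :: "nat set set \<Rightarrow> bool" where
  "Pi11_family \<A> \<longleftrightarrow> (\<exists>\<psi>. \<A> = {A. \<forall>X. sat (\<lambda>_. 0) ((\<lambda>_. {})(0 := X, 1 := A)) \<psi>})"

definition Sigma11_family :: "nat set set \<Rightarrow> bool" where
  "Sigma11_family \<A> \<longleftrightarrow> Pi11_family (- \<A>)"

definition Delta11_family :: "nat set set \<Rightarrow> bool" where
  "Delta11_family \<A> \<longleftrightarrow> Sigma11_family \<A> \<and> Pi11_family \<A>"


section \<open>Upper sets and filters\<close>

definition upper_set :: "nat set set \<Rightarrow> bool" where
  "upper_set \<U> \<longleftrightarrow> \<U> \<noteq> {} \<and> (\<forall>A\<in>\<U>. \<forall>B. A \<subseteq> B \<longrightarrow> B \<in> \<U>) \<and> {} \<notin> \<U>"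

definition set_filter :: "nat set set \<Rightarrow> bool" where
  "set_filter \<F> \<longleftrightarrow> upper_set \<F> \<and> (\<forall>A\<in>\<F>. \<forall>B\<in>\<F>. A \<inter> B \<in> \<F>)"

text \<open>
  A non-principal filter in this sense need not contain the cofinite sets: the cofinite sets
  containing 0 form one. A function LT-below such a filter is computable, as Merlin can always reply
  with a common element; hence filters are additionally required to have empty intersection where
  that matters.
\<close>

definition principal_filter :: "nat set set \<Rightarrow> bool" where
  "principal_filter \<F> \<longleftrightarrow> (\<exists>S. \<F> = {A. S \<subseteq> A})"

text \<open>A family indexed by a subset \<open>I\<close> of the numbers is a partial map with domain \<open>I\<close>.\<close>

type_synonym upper_seq = "nat \<rightharpoonup> nat set set"

definition is_upper_seq :: "upper_seq \<Rightarrow> bool" where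
  "is_upper_seq U \<longleftrightarrow> (\<forall>\<U>\<in>ran U. upper_set \<U>)"

definition seq_of_upper_set :: "nat set set \<Rightarrow> upper_seq" where
  "seq_of_upper_set \<U> = [0 \<mapsto> \<U>]"

definition seq_of_fun :: "(nat \<Rightarrow> nat) \<Rightarrow> upper_seq" where
  "seq_of_fun f = (\<lambda>n. Some {A. f n \<in> A})"

lemma is_upper_seq_seq_of_upper_set: "upper_set \<U> \<Longrightarrow> is_upper_seq (seq_of_upper_set \<U>)"
  by (simp add: is_upper_seq_def seq_of_upper_set_def)

lemma is_upper_seq_seq_of_fun: "is_upper_seq (seq_of_fun f)"
  by (auto simp: is_upper_seq_def seq_of_fun_def upper_set_def ran_def)


section \<open>The LT-game\<close>

text \<open>
  Merlin's number moves are collected in an infinite sequence \<open>x\<close>; the entries after the end of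
  the play are irrelevant. Arthur's move in round \<open>n\<close> depends on \<open>history x n\<close> only. Nimue's move
  depends on Merlin's moves, including the secret set \<open>A\<close>; all other moves in the history are
  determined by these and the two strategies.
\<close>

type_synonym arthur = "nat list \<Rightarrow> nat option"
type_synonym nimue = "nat set \<Rightarrow> nat list \<Rightarrow> nat set"

definition history :: "(nat \<Rightarrow> nat) \<Rightarrow> nat \<Rightarrow> nat list" where
  "history x n = map x [0..<Suc n]"

definition legal_query :: "upper_seq \<Rightarrow> arthur \<Rightarrow> nimue \<Rightarrow> nat set \<Rightarrow> nat list \<Rightarrow> bool" where
  "legal_query V \<phi> \<eta> A \<sigma> \<longleftrightarrow>
     (\<exists>u \<V>. \<phi> \<sigma> = Some (prod_encode (0, u)) \<and> V u = Some \<V> \<and> \<eta> A \<sigma> \<in> \<V>)"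

definition correct_output :: "arthur \<Rightarrow> nat set \<Rightarrow> nat list \<Rightarrow> bool" where
  "correct_output \<phi> A \<sigma> \<longleftrightarrow> (\<exists>u. \<phi> \<sigma> = Some (prod_encode (1, u)) \<and> u \<in> A)"

text \<open>
  The team wins a play if it reaches, through legal queries, a round \<open>n\<close> in which Arthur gives a
  correct output, or in which the team moves legally and Merlin's reply is illegal. If Merlin's
  opening is illegal there is nothing to show.
\<close>

definition winning_strategy :: "upper_seq \<Rightarrow> upper_seq \<Rightarrow> arthur \<Rightarrow> nimue \<Rightarrow> bool" where
  "winning_strategy U V \<phi> \<eta> \<longleftrightarrow>
     (\<forall>A x \<U>. U (x 0) = Some \<U> \<and> A \<in> \<U> \<longrightarrow>
        (\<exists>n. (\<forall>m<n. legal_query V \<phi> \<eta> A (history x m)) \<and>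
             (correct_output \<phi> A (history x n) \<or>
              legal_query V \<phi> \<eta> A (history x n) \<and> x (Suc n) \<notin> \<eta> A (history x n))))"

definition LT_le :: "upper_seq \<Rightarrow> upper_seq \<Rightarrow> bool"  (infix "\<le>\<^sub>L\<^sub>T" 50) where
  "U \<le>\<^sub>L\<^sub>T V \<longleftrightarrow> (\<exists>\<phi> \<eta>. partial_computable_on_strings \<phi> \<and> winning_strategy U V \<phi> \<eta>)"

end

theory Submission
  imports Defs "HOL-Library.Countable"
begin

text \<open>
  In one direction the graph of \<open>f\<close> is read off the game as a least fixed point; in the other the
  game supplies bounds for a search in an effective tree.

  Suppose that Arthur and Nimue win the game for \<open>f\<close> against \<open>\<F>\<close>. Say that a position forces \<open>m\<close>
  if Arthur answers \<open>m\<close> there, or if he makes a query and the replies leading to positions that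
  force \<open>m\<close> form a set in \<open>\<F>\<close>. A position that does not force \<open>f n\<close> can be kept that way by Merlin for
  ever, so the opening \<open>[n]\<close> forces \<open>f n\<close>; and it forces nothing else, because two sets in \<open>\<F>\<close>
  intersect. Forcing is the least fixed point of a monotone operator. Hence \<open>[n]\<close> forces \<open>m\<close> iff
  every set \<open>Y\<close> of positions either contains \<open>[n]\<close> or fails to be closed, and failing to be closed
  is an existential number quantifier in front of conditions on the computation of Arthur and on
  membership in \<open>\<F>\<close>, all of them \<open>\<Pi>\<^sup>1\<^sub>1\<close>. Since \<open>\<Pi>\<^sup>1\<^sub>1\<close> is closed under number quantifiers and
  universal set quantifiers, the graph of \<open>f\<close> is \<open>\<Pi>\<^sup>1\<^sub>1\<close>, and so is its complement, as \<open>f\<close> is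
  total (\<open>hyperarithmetic_if_LT_le\<close>).

  Conversely, a \<open>\<Sigma>\<^sup>1\<^sub>1\<close> graph can be written as: \<open>m = f n\<close> iff some \<open>G\<close> satisfies the
  computable conditions \<open>C k \<langle>n, m\<rangle>\<close> for all \<open>k\<close>, where \<open>C k\<close> looks at \<open>G\<close> below \<open>k\<close> only
  (\<open>Sigma11_normal_form\<close>). The free filter \<open>\<F>\<close> contains all final segments, so Nimue can force
  the replies of Merlin to stay above \<open>f n\<close> and above a fixed \<open>G\<close> for \<open>f n\<close>. Arthur makes queries until
  exactly one \<open>m\<close> up to the first reply has a finite approximation to a \<open>G\<close> bounded by the replies.
  The value \<open>f n\<close> always passes this test, and any other value fails at some stage: otherwise
  compactness of the functions below the replies would produce a \<open>G\<close> for a wrong value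
  (\<open>LT_le_if_hyperarithmetic\<close>).
\<close>

section \<open>Substitution in arithmetical formulas\<close>

text \<open>
  For collecting finitely many of the bounds of the next lemmas into one.
\<close>

lemma uniform_bound:
  assumes "\<And>j::nat. \<exists>M. Q j M" and "\<And>j M M'. Q j M \<Longrightarrow> M \<le> (M'::nat) \<Longrightarrow> Q j M'"
  shows "\<exists>M. \<forall>j<B. Q j M"
proof (induction B)
  case (Suc B)
  then obtain M where "\<forall>j<B. Q j M" by blast
  moreover obtain M' where "Q B M'" using assms(1) by blast
  ultimately have "\<forall>j<Suc B. Q j (max M M')"
    using assms(2) by (auto simp: less_Suc_eq intro: assms(2))
  then show ?case ..
qed simp

lemma term_val_finite_support:
  "\<exists>B. \<forall>e e'. (\<forall>i<B. e i = e' i) \<longrightarrow> term_val e t = term_val e' t"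
proof (induction t)
  case (Var i)
  show ?case by (rule exI[of _ "Suc i"]) simp
next
  case (Plus t u)
  then obtain B C where BC: "\<And>e e'. \<forall>i<B. e i = e' i \<Longrightarrow> term_val e t = term_val e' t"
    "\<And>e e'. \<forall>i<C. e i = e' i \<Longrightarrow> term_val e u = term_val e' u" by blast
  have "term_val e (Plus t u) = term_val e' (Plus t u)" if "\<forall>i<max B C. e i = e' i" for e e'
    unfolding term_val.simps by (intro arg_cong2[where f = "(+)"] BC) (use that in auto)
  then show ?case by blast
next
  case (Times t u)
  then obtain B C where BC: "\<And>e e'. \<forall>i<B. e i = e' i \<Longrightarrow> term_val e t = term_val e' t"
    "\<And>e e'. \<forall>i<C. e i = e' i \<Longrightarrow> term_val e u = term_val e' u" by blast
  have "term_val e (Times t u) = term_val e' (Times t u)" if "\<forall>i<max B C. e i = e' i" for e e'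
    unfolding term_val.simps by (intro arg_cong2[where f = "(*)"] BC) (use that in auto)
  then show ?case by blast
qed auto

lemma term_pair_finite_support:
  "\<exists>B. \<forall>e e'. (\<forall>i<B. e i = e' i) \<longrightarrow> term_val e t = term_val e' t \<and> term_val e u = term_val e' u"
proof -
  obtain B C where BC: "\<And>e e'. \<forall>i<B. e i = e' i \<Longrightarrow> term_val e t = term_val e' t"
    "\<And>e e'. \<forall>i<C. e i = e' i \<Longrightarrow> term_val e u = term_val e' u"
    using term_val_finite_support[of t] term_val_finite_support[of u] by blast
  show ?thesis by (intro exI[of _ "max B C"] allI impI conjI BC) auto
qed

lemma sat_finite_support:
  "\<exists>B. \<forall>e e' E E'. (\<forall>i<B. e i = e' i \<and> E i = E' i) \<longrightarrow> sat e E p = sat e' E' p"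
proof (induction p)
  case (Eq t u)
  obtain B where B: "\<And>e e'. \<forall>i<B. e i = e' i \<Longrightarrow> term_val e t = term_val e' t \<and> term_val e u = term_val e' u"
    using term_pair_finite_support by blast
  show ?case by (intro exI[of _ B] allI impI) (use B in \<open>metis sat.simps(1)\<close>)
next
  case (Less t u)
  obtain B where B: "\<And>e e'. \<forall>i<B. e i = e' i \<Longrightarrow> term_val e t = term_val e' t \<and> term_val e u = term_val e' u"
    using term_pair_finite_support by blast
  show ?case by (intro exI[of _ B] allI impI) (use B in \<open>metis sat.simps(2)\<close>)
next
  case (In t k)
  obtain B where B: "\<And>e e'. \<forall>i<B. e i = e' i \<Longrightarrow> term_val e t = term_val e' t"
    using term_val_finite_support by blast
  have "sat e E (In t k) = sat e' E' (In t k)" if "\<forall>i<max B (Suc k). e i = e' i \<and> E i = E' i" for e e' E E'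
    unfolding sat.simps by (intro arg_cong2[where f = "(\<in>)"] B) (use that in auto)
  then show ?case by blast
next
  case (Conj p q)
  obtain B where B: "\<And>e e' E E'. (\<forall>i<B. e i = e' i \<and> E i = E' i) \<Longrightarrow> sat e E p = sat e' E' p"
    using Conj.IH(1) by blast
  obtain C where C: "\<And>e e' E E'. (\<forall>i<C. e i = e' i \<and> E i = E' i) \<Longrightarrow> sat e E q = sat e' E' q"
    using Conj.IH(2) by blast
  have "sat e E (Conj p q) = sat e' E' (Conj p q)"
    if "\<forall>i<max B C. e i = e' i \<and> E i = E' i" for e e' E E'
    unfolding sat.simps by (intro arg_cong2[where f = "(\<and>)"] B C) (use that in auto)
  then show ?case by blast
next
  case (Forall i p)
  then obtain B where B: "\<And>e e' E E'. (\<forall>i<B. e i = e' i \<and> E i = E' i) \<Longrightarrow> sat e E p = sat e' E' p"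
    by blast
  have "sat (e(i := n)) E p = sat (e'(i := n)) E' p" if "\<forall>i<B. e i = e' i \<and> E i = E' i" for e e' E E' n
    by (rule B) (use that in auto)
  then have "sat e E (Forall i p) = sat e' E' (Forall i p)"
    if "\<forall>i<B. e i = e' i \<and> E i = E' i" for e e' E E'
    unfolding sat.simps using that by blast
  then show ?case by blast
qed auto

lemma term_substitution: "\<exists>t'. \<forall>e. term_val e t' = term_val (\<lambda>i. term_val e (s i)) t"
proof (induction t)
  case (Plus t u)
  then obtain t' u' where "\<forall>e. term_val e t' = term_val (\<lambda>i. term_val e (s i)) t"
    "\<forall>e. term_val e u' = term_val (\<lambda>i. term_val e (s i)) u" by blast
  then have "\<forall>e. term_val e (Plus t' u') = term_val (\<lambda>i. term_val e (s i)) (Plus t u)" by simp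
  then show ?case ..
next
  case (Times t u)
  then obtain t' u' where "\<forall>e. term_val e t' = term_val (\<lambda>i. term_val e (s i)) t"
    "\<forall>e. term_val e u' = term_val (\<lambda>i. term_val e (s i)) u" by blast
  then have "\<forall>e. term_val e (Times t' u') = term_val (\<lambda>i. term_val e (s i)) (Times t u)" by simp
  then show ?case ..
qed (auto intro: exI[of _ Zer] exI[of _ One])

text \<open>
  Simultaneous substitution of the terms \<open>s i\<close> for the number variables and of the formulas \<open>q i\<close>
  for the set variables; variable 0 of \<open>q i\<close> is the element whose membership is asked for, and the
  others are shifted. The case of \<^const>\<open>In\<close> is left as an assumption so that the lemma serves twice:
  with \<open>q i = In (Var 0) i\<close> the assumption is trivial and the lemma yields number substitution, and this
  in turn provides the assumption for arbitrary \<open>q i\<close>.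
\<close>

lemma formula_substitution:
  assumes In_case: "\<And>i t. \<exists>p'. \<forall>e E. sat e E p' \<longleftrightarrow> sat (case_nat (term_val e t) e) E (q i)"
  shows "\<exists>p'. \<forall>e E. sat e E p' \<longleftrightarrow>
    sat (\<lambda>i. term_val e (s i)) (\<lambda>i. {x. sat (case_nat x e) E (q i)}) p"
proof (induction p arbitrary: s)
  case (Eq t u)
  obtain t' u' where "\<forall>e. term_val e t' = term_val (\<lambda>i. term_val e (s i)) t"
    "\<forall>e. term_val e u' = term_val (\<lambda>i. term_val e (s i)) u" using term_substitution by meson
  then show ?case by (intro exI[of _ "Eq t' u'"]) simp
next
  case (Less t u)
  obtain t' u' where "\<forall>e. term_val e t' = term_val (\<lambda>i. term_val e (s i)) t"
    "\<forall>e. term_val e u' = term_val (\<lambda>i. term_val e (s i)) u" using term_substitution by meson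
  then show ?case by (intro exI[of _ "Less t' u'"]) simp
next
  case (In t k)
  obtain t' where t': "\<forall>e. term_val e t' = term_val (\<lambda>i. term_val e (s i)) t"
    using term_substitution by meson
  show ?case using In_case[of t' k] t' by simp
next
  case (Neg p)
  then obtain p' where "\<forall>e E. sat e E p' \<longleftrightarrow>
    sat (\<lambda>i. term_val e (s i)) (\<lambda>i. {x. sat (case_nat x e) E (q i)}) p" by blast
  then show ?case by (intro exI[of _ "Neg p'"]) simp
next
  case (Conj p1 p2)
  obtain p1' where "\<forall>e E. sat e E p1' \<longleftrightarrow>
    sat (\<lambda>i. term_val e (s i)) (\<lambda>i. {x. sat (case_nat x e) E (q i)}) p1" using Conj by blast
  moreover obtain p2' where "\<forall>e E. sat e E p2' \<longleftrightarrow>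
    sat (\<lambda>i. term_val e (s i)) (\<lambda>i. {x. sat (case_nat x e) E (q i)}) p2" using Conj by blast
  ultimately show ?case by (intro exI[of _ "Conj p1' p2'"]) simp
next
  case (Forall i p)
  obtain B where B: "\<And>e e' E E'. (\<forall>i<B. e i = e' i \<and> E i = E' i) \<Longrightarrow> sat e E p = sat e' E' p"
    using sat_finite_support[of p] by blast
  have "\<exists>M. \<forall>j<B. (\<forall>e e'. (\<forall>i<M. e i = e' i) \<longrightarrow> term_val e (s j) = term_val e' (s j))"
    by (rule uniform_bound[OF term_val_finite_support]) (meson less_le_trans)
  then obtain M1 where M1: "\<And>j e e'. j < B \<Longrightarrow> \<forall>i<M1. e i = e' i \<Longrightarrow> term_val e (s j) = term_val e' (s j)"
    by blast
  have "\<exists>M. \<forall>j<B. (\<forall>e e' E E'. (\<forall>i<M. e i = e' i \<and> E i = E' i) \<longrightarrow> sat e E (q j) = sat e' E' (q j))"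
    by (rule uniform_bound[OF sat_finite_support]) (meson less_le_trans)
  then obtain M2 where M2: "\<forall>j<B. \<forall>e e' E E'. (\<forall>i<M2. e i = e' i \<and> E i = E' i) \<longrightarrow>
      sat e E (q j) = sat e' E' (q j)" ..
  \<comment> \<open>A fresh variable for \<open>i\<close>, so that no term or formula substituted in is captured.\<close>
  define M where "M = max M1 M2"
  obtain p' where p': "\<forall>e E. sat e E p' \<longleftrightarrow>
    sat (\<lambda>j. term_val e ((s(i := Var M)) j)) (\<lambda>i. {x. sat (case_nat x e) E (q i)}) p"
    using Forall by blast
  have "sat (e(M := n)) E p' \<longleftrightarrow>
    sat ((\<lambda>j. term_val e (s j))(i := n)) (\<lambda>i. {x. sat (case_nat x e) E (q i)}) p" for e E n
  proof -
    have "term_val (e(M := n)) (s j) = term_val e (s j)" if "j < B" for j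
      by (rule M1) (use that in \<open>auto simp: M_def\<close>)
    moreover have "sat (case_nat x (e(M := n))) E (q j) \<longleftrightarrow> sat (case_nat x e) E (q j)" if "j < B" for j x
      by (rule M2[rule_format]) (use that in \<open>auto simp: M_def split: nat.split\<close>)
    ultimately show ?thesis
      unfolding p'[rule_format] by (intro B) auto
  qed
  then show ?case by (intro exI[of _ "Forall M p'"]) simp
qed

section \<open>Arithmetical predicates\<close>

text \<open>
  Formulas are handled through the predicates they define. Quantifier rules follow the convention
  that the bound variable becomes variable 0 and all others are shifted by \<^const>\<open>Suc\<close>, so that
  definability of a concrete predicate can be derived by applying the rules along its structure.
\<close>

definition arith :: "((nat \<Rightarrow> nat) \<Rightarrow> (nat \<Rightarrow> nat set) \<Rightarrow> bool) \<Rightarrow> bool" where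
  "arith P \<longleftrightarrow> (\<exists>p. \<forall>e E. P e E \<longleftrightarrow> sat e E p)"

text \<open>
  The semantic form of substitution, from which renaming of variables and the manipulation of set
  quantifiers below are obtained.
\<close>

lemma arith_substitution:
  assumes P: "arith P" and Q: "\<And>i. arith (\<lambda>e E. Q i (e 0) (\<lambda>j. e (Suc j)) E)"
  shows "arith (\<lambda>e E. P (\<lambda>i. term_val e (s i)) (\<lambda>i. {x. Q i x e E}))"
proof -
  obtain p where p: "\<And>e E. P e E \<longleftrightarrow> sat e E p" using P unfolding arith_def by blast
  obtain q where q: "\<And>i e E. Q i (e 0) (\<lambda>j. e (Suc j)) E \<longleftrightarrow> sat e E (q i)"
    using Q unfolding arith_def by metis
  have num: "\<exists>p'. \<forall>e E. sat e E p' \<longleftrightarrow> sat (\<lambda>i. term_val e (s i)) E p" for p s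
  proof -
    have "\<exists>p'. \<forall>e E. sat e E p' \<longleftrightarrow> sat (case_nat (term_val e t) e) E (In (Var 0) i)" for i t
      by (intro exI[of _ "In t i"]) simp
    from formula_substitution[of "In (Var 0)", OF this] show ?thesis by simp
  qed
  have "\<exists>p'. \<forall>e E. sat e E p' \<longleftrightarrow> sat (case_nat (term_val e t) e) E (q i)" for i t
  proof -
    have "(\<lambda>i. term_val e (case_nat t Var i)) = case_nat (term_val e t) e" for e
      by (auto split: nat.split)
    then show ?thesis using num[of "case_nat t Var" "q i"] by simp
  qed
  from formula_substitution[where q = q and s = s and p = p, OF this]
  obtain p' where p': "\<forall>e E. sat e E p' \<longleftrightarrow>
    sat (\<lambda>i. term_val e (s i)) (\<lambda>i. {x. sat (case_nat x e) E (q i)}) p" ..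
  have "sat (case_nat x e) E (q i) \<longleftrightarrow> Q i x e E" for i x e E
    using q[of i "case_nat x e" E] by simp
  then show ?thesis unfolding arith_def p by (intro exI[of _ p']) (simp add: p')
qed

lemma arith_rename: "arith P \<Longrightarrow> arith (\<lambda>e E. P (\<lambda>i. e (r i)) E)"
  using arith_substitution[of P "\<lambda>i x e E. x \<in> E i" "\<lambda>i. Var (r i)"]
  by (force simp: arith_def intro: exI[of _ "In (Var 0) _"])

lemma arith_not: "arith P \<Longrightarrow> arith (\<lambda>e E. \<not> P e E)"
  unfolding arith_def by (metis sat.simps(4))

lemma arith_conj: "arith P \<Longrightarrow> arith Q \<Longrightarrow> arith (\<lambda>e E. P e E \<and> Q e E)"
  unfolding arith_def by (metis sat.simps(5))

lemma arith_disj: "arith P \<Longrightarrow> arith Q \<Longrightarrow> arith (\<lambda>e E. P e E \<or> Q e E)"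
  using arith_not[OF arith_conj[OF arith_not arith_not, of P Q]] by simp

text \<open>
  The formula calculus has named variables. The variable quantified over is one beyond the support
  of the formula, to which variable 0 is first renamed.
\<close>

lemma arith_all:
  assumes "arith (\<lambda>e E. P (e 0) (\<lambda>j. e (Suc j)) E)"
  shows "arith (\<lambda>e E. \<forall>n. P n e E)"
proof -
  obtain p where p: "\<And>e E. P (e 0) (\<lambda>j. e (Suc j)) E \<longleftrightarrow> sat e E p"
    using assms unfolding arith_def by blast
  obtain B where B: "\<And>e e' E E'. (\<forall>i<B. e i = e' i \<and> E i = E' i) \<Longrightarrow> sat e E p = sat e' E' p"
    using sat_finite_support[of p] by blast
  have "arith (\<lambda>e E. sat e E p)" by (auto simp: arith_def)
  from arith_rename[OF this, of "case_nat B id"]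
  obtain p' where p': "\<And>e E. sat (\<lambda>i. e (case_nat B id i)) E p \<longleftrightarrow> sat e E p'"
    unfolding arith_def by blast
  have "sat (e(B := n)) E p' \<longleftrightarrow> P n e E" for n e E
  proof -
    have "sat (e(B := n)) E p' \<longleftrightarrow> sat (case_nat n e) E p"
      unfolding p'[symmetric] by (rule B) (auto split: nat.split)
    then show ?thesis using p[of "case_nat n e"] by simp
  qed
  then show ?thesis unfolding arith_def by (intro exI[of _ "Forall B p'"]) simp
qed

lemma arith_ex:
  assumes "arith (\<lambda>e E. P (e 0) (\<lambda>j. e (Suc j)) E)"
  shows "arith (\<lambda>e E. \<exists>n. P n e E)"
  using arith_not[OF arith_all[OF arith_not[OF assms]]] by simp

text \<open>
  Functions with an arithmetical graph may be used as if they were terms. This is what makes the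
  pairing function available.
\<close>

definition arith_fun :: "((nat \<Rightarrow> nat) \<Rightarrow> nat) \<Rightarrow> bool" where
  "arith_fun f \<longleftrightarrow> arith (\<lambda>e E. e 0 = f (\<lambda>j. e (Suc j)))"

lemma arith_fun_rename: "arith_fun f \<Longrightarrow> arith_fun (\<lambda>e. f (\<lambda>j. e (r j)))"
  unfolding arith_fun_def
  by (drule arith_rename[where r = "case_nat 0 (\<lambda>j. Suc (r j))"]) simp

lemma arith_let:
  assumes "arith_fun f" "arith (\<lambda>e E. P (e 0) (\<lambda>j. e (Suc j)) E)"
  shows "arith (\<lambda>e E. P (f e) e E)"
  using arith_ex[of "\<lambda>n e E. n = f e \<and> P n e E", OF arith_conj[OF assms[unfolded arith_fun_def]]]
  by simp

lemma arith_let2: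
  assumes f: "arith_fun f" and g: "arith_fun g"
    and "arith (\<lambda>e E. P (e (Suc 0)) (e 0) (\<lambda>j. e (Suc (Suc j))) E)"
  shows "arith (\<lambda>e E. P (f e) (g e) e E)"
proof (rule arith_let[OF f, of "\<lambda>n e E. P n (g e) e E"])
  show "arith (\<lambda>e E. P (e 0) (g (\<lambda>j. e (Suc j))) (\<lambda>j. e (Suc j)) E)"
    by (rule arith_let[OF arith_fun_rename[OF g], of "\<lambda>n e E. P (e 0) n (\<lambda>j. e (Suc j)) E"])
      (use assms(3) in simp)
qed

lemma arith_eq: "arith_fun f \<Longrightarrow> arith_fun g \<Longrightarrow> arith (\<lambda>e E. f e = g e)"
  by (rule arith_let2) (auto simp: arith_def intro: exI[of _ "Eq (Var 1) (Var 0)"])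

lemma arith_less: "arith_fun f \<Longrightarrow> arith_fun g \<Longrightarrow> arith (\<lambda>e E. f e < g e)"
  by (rule arith_let2) (auto simp: arith_def intro: exI[of _ "Less (Var 1) (Var 0)"])

lemma arith_mem: "arith_fun f \<Longrightarrow> arith (\<lambda>e E. f e \<in> E k)"
  by (rule arith_let) (auto simp: arith_def intro: exI[of _ "In (Var 0) k"])

lemma arith_fun_term: "arith_fun (\<lambda>e. term_val e t)"
proof -
  obtain t' where "\<And>e. term_val e t' = term_val (\<lambda>i. term_val e (Var (Suc i))) t"
    using term_substitution[of "\<lambda>i. Var (Suc i)" t] by blast
  then show ?thesis unfolding arith_fun_def arith_def by (intro exI[of _ "Eq (Var 0) t'"]) simp
qed

lemma arith_fun_var: "arith_fun (\<lambda>e. e i)"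
  using arith_fun_term[of "Var i"] by simp

lemma arith_fun_comp2:
  assumes "arith_fun f" "arith_fun g" "arith_fun (\<lambda>e. h (e (Suc 0)) (e 0))"
  shows "arith_fun (\<lambda>e. h (f e) (g e))"
  unfolding arith_fun_def
  by (rule arith_let2[OF assms(1,2)[THEN arith_fun_rename]])
    (rule arith_eq[OF arith_fun_var arith_fun_rename[OF assms(3), of "\<lambda>i. i", simplified]])

lemma arith_fun_plus: "arith_fun f \<Longrightarrow> arith_fun g \<Longrightarrow> arith_fun (\<lambda>e. f e + g e)"
  by (rule arith_fun_comp2) (use arith_fun_term[of "Plus (Var 1) (Var 0)"] in simp_all)

lemma arith_fun_const: "arith_fun (\<lambda>e. c)"
proof (induction c)
  case 0
  show ?case using arith_fun_term[of Zer] by simp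
next
  case (Suc c)
  show ?case using arith_fun_plus[OF Suc arith_fun_term[of One]] by simp
qed

lemma arith_fun_Suc: "arith_fun f \<Longrightarrow> arith_fun (\<lambda>e. Suc (f e))"
  using arith_fun_plus[OF _ arith_fun_const[of 1]] by simp

lemma two_prod_encode: "2 * prod_encode (a, b) = (a + b) * (a + b + 1) + 2 * a"
proof -
  have "2 * triangle n = n * Suc n" for n by (induction n) auto
  then show ?thesis by (simp add: prod_encode_def)
qed

lemma arith_fun_prod_encode:
  assumes "arith_fun f" "arith_fun g"
  shows "arith_fun (\<lambda>e. prod_encode (f e, g e))"
proof (rule arith_fun_comp2[OF assms])
  have "(z = prod_encode (a, b)) \<longleftrightarrow> z + z = (a + b) * (a + b + 1) + (a + a)" for z a b
    using two_prod_encode[of a b] by linarith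
  then show "arith_fun (\<lambda>e. prod_encode (e (Suc 0), e 0))"
    unfolding arith_fun_def arith_def
    by (intro exI[of _ "Eq (Plus (Var 0) (Var 0)) (Plus (Times (Plus (Var (Suc (Suc 0))) (Var 1))
        (Plus (Plus (Var (Suc (Suc 0))) (Var 1)) One)) (Plus (Var (Suc (Suc 0))) (Var (Suc (Suc 0)))))"]) simp
qed

lemmas arith_fun_intros = arith_fun_prod_encode arith_fun_Suc arith_fun_var arith_fun_const
lemmas arith_intros = arith_not arith_conj arith_disj arith_all arith_ex arith_eq arith_less arith_mem
  arith_fun_intros

section \<open>\<open>\<Pi>\<^sup>1\<^sub>1\<close> predicates\<close>

text \<open>
  The quantified set becomes set variable 0, and the free set variables are shifted.
\<close>

definition Pi11 :: "((nat \<Rightarrow> nat) \<Rightarrow> (nat \<Rightarrow> nat set) \<Rightarrow> bool) \<Rightarrow> bool" where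
  "Pi11 P \<longleftrightarrow> (\<exists>Q. arith Q \<and> (\<forall>e E. P e E \<longleftrightarrow> (\<forall>X. Q e (case_nat X E))))"

lemma Pi11I: "arith Q \<Longrightarrow> (\<And>e E. P e E \<longleftrightarrow> (\<forall>X. Q e (case_nat X E))) \<Longrightarrow> Pi11 P"
  unfolding Pi11_def by blast

lemma Pi11E:
  assumes "Pi11 P"
  obtains Q where "arith Q" "\<And>e E. P e E \<longleftrightarrow> (\<forall>X. Q e (case_nat X E))"
  using assms unfolding Pi11_def by blast

lemma arith_set_rename: "arith P \<Longrightarrow> arith (\<lambda>e E. P e (\<lambda>i. E (r i)))"
  using arith_substitution[of P "\<lambda>i x e E. x \<in> E (r i)" Var]
  by (simp add: arith_mem arith_fun_var)

lemma Pi11_arith: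
  assumes "arith P"
  shows "Pi11 P"
  by (rule Pi11I[OF arith_set_rename[OF assms, of Suc]]) simp

lemma Pi11_conj:
  assumes "Pi11 P" "Pi11 Q"
  shows "Pi11 (\<lambda>e E. P e E \<and> Q e E)"
proof -
  obtain P' where P': "arith P'" "\<And>e E. P e E \<longleftrightarrow> (\<forall>X. P' e (case_nat X E))" by (rule Pi11E[OF assms(1)]) blast
  obtain Q' where Q': "arith Q'" "\<And>e E. Q e E \<longleftrightarrow> (\<forall>X. Q' e (case_nat X E))" by (rule Pi11E[OF assms(2)]) blast
  show ?thesis by (rule Pi11I[OF arith_conj[OF P'(1) Q'(1)]]) (auto simp: P' Q')
qed

lemma Pi11_all:
  assumes "Pi11 (\<lambda>e E. P (e 0) (\<lambda>j. e (Suc j)) E)"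
  shows "Pi11 (\<lambda>e E. \<forall>n. P n e E)"
proof -
  obtain Q where Q: "arith Q" "\<And>e E. P (e 0) (\<lambda>j. e (Suc j)) E \<longleftrightarrow> (\<forall>X. Q e (case_nat X E))"
    by (rule Pi11E[OF assms]) blast
  have "case_nat (e 0) (\<lambda>j. e (Suc j)) = e" for e :: "nat \<Rightarrow> nat" by (auto split: nat.split)
  then have "arith (\<lambda>e E. \<forall>n. Q (case_nat n e) E)"
    by (intro arith_all) (use Q(1) in simp)
  then show ?thesis
    by (rule Pi11I) (use Q(2)[of "case_nat _ _"] in auto)
qed

text \<open>
  By countable choice, \<open>\<exists>n. \<forall>X\<close> is \<open>\<forall>X. \<exists>n\<close> when the section of \<open>X\<close> at \<open>n\<close> is used in
  place of \<open>X\<close>.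
\<close>

lemma Pi11_ex:
  assumes "Pi11 (\<lambda>e E. P (e 0) (\<lambda>j. e (Suc j)) E)"
  shows "Pi11 (\<lambda>e E. \<exists>n. P n e E)"
proof -
  obtain Q where Q: "arith Q" "\<And>e E. P (e 0) (\<lambda>j. e (Suc j)) E \<longleftrightarrow> (\<forall>X. Q e (case_nat X E))"
    by (rule Pi11E[OF assms]) blast
  define R where "R = (\<lambda>i x e (E :: nat \<Rightarrow> nat set).
    case i of 0 \<Rightarrow> prod_encode (e (0::nat), x) \<in> E 0 | Suc j \<Rightarrow> x \<in> E (Suc j))"
  have eta: "case_nat (e 0) (\<lambda>j. e (Suc j)) = e" for e :: "nat \<Rightarrow> nat" by (auto split: nat.split)
  have sec: "(\<lambda>i. {x. R i x e (case_nat X E)}) = case_nat {x. prod_encode (e 0, x) \<in> X} E" for e X E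
    by (auto simp: R_def split: nat.split)
  have "arith (\<lambda>e E. R i (e 0) (\<lambda>j. e (Suc j)) E)" for i
    unfolding R_def by (cases i) (auto intro!: arith_intros)
  from arith_substitution[of Q R Var, OF Q(1) this]
  have "arith (\<lambda>e E. Q e (\<lambda>i. {x. R i x e E}))" by simp
  then have "arith (\<lambda>e E. \<exists>n. Q (case_nat n e) (\<lambda>i. {x. R i x (case_nat n e) E}))"
    by (intro arith_ex) (simp add: eta)
  then show ?thesis
  proof (rule Pi11I)
    fix e E
    have P: "P n e E \<longleftrightarrow> (\<forall>X. Q (case_nat n e) (case_nat X E))" for n
      using Q(2)[of "case_nat n e" E] by simp
    have "(\<exists>n. \<forall>X. Q (case_nat n e) (case_nat X E)) \<longleftrightarrow>
      (\<forall>X. \<exists>n. Q (case_nat n e) (case_nat {x. prod_encode (n, x) \<in> X} E))" (is "?l \<longleftrightarrow> ?r")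
    proof
      assume r: ?r
      show ?l
      proof (rule ccontr)
        assume "\<not> ?l"
        then obtain X where X: "\<And>n. \<not> Q (case_nat n e) (case_nat (X n) E)" by metis
        \<comment> \<open>The counterexamples \<open>X n\<close> are the sections of one set.\<close>
        have "{x. prod_encode (n, x) \<in> {prod_encode (n, x) |n x. x \<in> X n}} = X n" for n by auto
        then show False using X r[rule_format, of "{prod_encode (n, x) |n x. x \<in> X n}"] by metis
      qed
    qed blast
    then show "(\<exists>n. P n e E) \<longleftrightarrow>
      (\<forall>X. \<exists>n. Q (case_nat n e) (\<lambda>i. {x. R i x (case_nat n e) (case_nat X E)}))"
      by (simp add: P sec)
  qed
qed

lemma Pi11_rename:
  assumes "Pi11 P"
  shows "Pi11 (\<lambda>e E. P (\<lambda>i. e (r i)) E)"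
proof -
  obtain Q where Q: "arith Q" "\<And>e E. P e E \<longleftrightarrow> (\<forall>X. Q e (case_nat X E))" by (rule Pi11E[OF assms]) blast
  show ?thesis by (rule Pi11I[OF arith_rename[OF Q(1), of r]]) (simp add: Q)
qed

text \<open>
  A disjunction is an existential number quantifier over the two disjuncts, so \<open>Pi11_ex\<close>
  applies.
\<close>

lemma Pi11_disj:
  assumes "Pi11 P" "Pi11 Q"
  shows "Pi11 (\<lambda>e E. P e E \<or> Q e E)"
proof -
  have guard: "Pi11 (\<lambda>e E. A e E \<or> R e E)" if A: "arith A" and "Pi11 R" for A R
  proof -
    obtain R' where R': "arith R'" "\<And>e E. R e E \<longleftrightarrow> (\<forall>X. R' e (case_nat X E))"
      by (rule Pi11E[OF \<open>Pi11 R\<close>]) blast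
    show ?thesis
      by (rule Pi11I[OF arith_disj[OF arith_set_rename[OF A, of Suc] R'(1)]]) (auto simp: R')
  qed
  have "Pi11 (\<lambda>e E. \<exists>n::nat. (n \<noteq> 0 \<or> P e E) \<and> (n = 0 \<or> Q e E))"
    by (intro Pi11_ex Pi11_conj guard arith_intros assms[THEN Pi11_rename])
  moreover have "(\<exists>n::nat. (n \<noteq> 0 \<or> p) \<and> (n = 0 \<or> q)) \<longleftrightarrow> p \<or> q" for p q by auto
  ultimately show ?thesis by simp
qed

text \<open>
  Two universally quantified sets are the sections at 0 and 1 of a single one.
\<close>

lemma Pi11_all_set:
  assumes "Pi11 (\<lambda>e E. P e (E 0) (\<lambda>j. E (Suc j)))"
  shows "Pi11 (\<lambda>e E. \<forall>X. P e X E)"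
proof -
  obtain Q where Q: "arith Q" "\<And>e E. P e (E 0) (\<lambda>j. E (Suc j)) \<longleftrightarrow> (\<forall>X. Q e (case_nat X E))"
    by (rule Pi11E[OF assms]) blast
  define R where "R = (\<lambda>i x (e :: nat \<Rightarrow> nat) (E :: nat \<Rightarrow> nat set).
    case i of 0 \<Rightarrow> prod_encode (0, x) \<in> E 0 | Suc j \<Rightarrow>
      (case j of 0 \<Rightarrow> prod_encode (1, x) \<in> E 0 | Suc k \<Rightarrow> x \<in> E (Suc k)))"
  have "arith (\<lambda>e E. R i (e 0) (\<lambda>j. e (Suc j)) E)" for i
  proof (cases i)
    case (Suc j)
    then show ?thesis by (cases j) (auto simp: R_def intro!: arith_intros)
  qed (auto simp: R_def intro!: arith_intros)
  from arith_substitution[of Q R Var, OF Q(1) this]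
  have "arith (\<lambda>e E. Q e (\<lambda>i. {x. R i x e E}))" by simp
  then show ?thesis
  proof (rule Pi11I)
    fix e E
    have sec: "(\<lambda>i. {x. R i x e (case_nat Z E)}) =
      case_nat {x. prod_encode (0, x) \<in> Z} (case_nat {x. prod_encode (1, x) \<in> Z} E)" for Z
      by (auto simp: R_def split: nat.split)
    have P: "P e Y E \<longleftrightarrow> (\<forall>X. Q e (case_nat X (case_nat Y E)))" for Y
      using Q(2)[of e "case_nat Y E"] by simp
    have "(\<forall>Y X. Q e (case_nat X (case_nat Y E))) \<longleftrightarrow> (\<forall>Z. Q e (\<lambda>i. {x. R i x e (case_nat Z E)}))"
      (is "?l \<longleftrightarrow> ?r")
    proof
      assume r: ?r
      show ?l
      proof (intro allI)
        fix Y X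
        let ?Z = "{prod_encode (0, x) |x. x \<in> X} \<union> {prod_encode (1, x) |x. x \<in> Y}"
        have "{x. prod_encode (0, x) \<in> ?Z} = X" "{x. prod_encode (1, x) \<in> ?Z} = Y" by auto
        then show "Q e (case_nat X (case_nat Y E))" using r[rule_format, of ?Z] unfolding sec by metis
      qed
    qed (simp add: sec)
    then show "(\<forall>Y. P e Y E) \<longleftrightarrow> (\<forall>Z. Q e (\<lambda>i. {x. R i x e (case_nat Z E)}))"
      by (simp add: P)
  qed
qed

text \<open>
  For using a binary relation already known to be \<open>\<Pi>\<^sup>1\<^sub>1\<close> as an atom.
\<close>

lemma Pi11_relation:
  assumes R: "Pi11 (\<lambda>e E. R (e 0) (e (Suc 0)))" and fg: "arith_fun f" "arith_fun g"
  shows "Pi11 (\<lambda>e E. R (f e) (g e))"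
proof -
  have "Pi11 (\<lambda>e E. \<exists>a b. (a = f e \<and> b = g e) \<and> R a b)"
    using Pi11_rename[OF R, of "case_nat 1 (case_nat 0 undefined)"]
    by (intro Pi11_ex, intro Pi11_conj[OF Pi11_arith] arith_intros fg[THEN arith_fun_rename]) simp
  then show ?thesis by simp
qed

lemma arith_False: "arith (\<lambda>e E. False)"
  using arith_eq[OF arith_fun_const[of 0] arith_fun_const[of 1]] by simp

lemma Pi11_eq: "arith_fun f \<Longrightarrow> arith_fun g \<Longrightarrow> Pi11 (\<lambda>e E. f e = g e)"
  by (intro Pi11_arith arith_eq)

lemma Pi11_neq: "arith_fun f \<Longrightarrow> arith_fun g \<Longrightarrow> Pi11 (\<lambda>e E. f e \<noteq> g e)"
  by (intro Pi11_arith arith_not arith_eq)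

lemma Pi11_not_less: "arith_fun f \<Longrightarrow> arith_fun g \<Longrightarrow> Pi11 (\<lambda>e E. \<not> f e < g e)"
  by (intro Pi11_arith arith_not arith_less)

lemma Pi11_mem: "arith_fun f \<Longrightarrow> Pi11 (\<lambda>e E. f e \<in> E k)"
  by (intro Pi11_arith arith_mem)

lemma Pi11_not_mem: "arith_fun f \<Longrightarrow> Pi11 (\<lambda>e E. f e \<notin> E k)"
  by (intro Pi11_arith arith_not arith_mem)

lemmas Pi11_intros = Pi11_conj Pi11_disj Pi11_all Pi11_ex Pi11_all_set
  Pi11_eq Pi11_neq Pi11_not_less Pi11_mem Pi11_not_mem arith_fun_intros

text \<open>
  The formula defining \<open>\<F>\<close> has the set in question as variable 1; the definition of that set is
  substituted for it.
\<close>

lemma Pi11_family_mem: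
  assumes F: "Pi11_family \<F>" and Q: "arith (\<lambda>e E. Q (e 0) (\<lambda>j. e (Suc j)) E)"
  shows "Pi11 (\<lambda>e E. {x. Q x e E} \<in> \<F>)"
proof -
  obtain p where p: "\<F> = {A. \<forall>X. sat (\<lambda>_. 0) ((\<lambda>_. {})(0 := X, 1 := A)) p}"
    using F unfolding Pi11_family_def by blast
  define S where "S = (\<lambda>i x e E. case i of 0 \<Rightarrow> x \<in> E (0::nat)
    | Suc j \<Rightarrow> if j = 0 then Q x e (\<lambda>i. E (Suc i)) else False)"
  have "arith (\<lambda>e E. S i (e 0) (\<lambda>j. e (Suc j)) E)" for i
  proof (cases i)
    case (Suc j)
    then show ?thesis
      using arith_set_rename[OF Q, of Suc] by (cases "j = 0") (auto simp: S_def arith_False)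
  qed (auto simp: S_def intro!: arith_intros)
  moreover have "arith (\<lambda>e E. sat e E p)" unfolding arith_def by blast
  ultimately have "arith (\<lambda>e E. sat (\<lambda>i. term_val e Zer) (\<lambda>i. {x. S i x e E}) p)"
    by (rule arith_substitution[rotated])
  then show ?thesis
  proof (rule Pi11I)
    fix e E
    have "(\<lambda>i. {x. S i x e (case_nat X E)}) = (\<lambda>_. {})(0 := X, 1 := {x. Q x e E})" for X
      by (intro ext) (auto simp: S_def split: nat.splits)
    then show "{x. Q x e E} \<in> \<F> \<longleftrightarrow>
        (\<forall>X. sat (\<lambda>i. term_val e Zer) (\<lambda>i. {x. S i x e (case_nat X E)}) p)"
      by (simp add: p)
  qed
qed

lemma Pi11_setI:
  assumes "Pi11 (\<lambda>e E. e 0 \<in> A)"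
  shows "Pi11_set A"
proof -
  obtain Q where "arith Q" and Q: "\<And>e E. e 0 \<in> A \<longleftrightarrow> (\<forall>X. Q e (case_nat X E))"
    by (rule Pi11E[OF assms]) blast
  then obtain p where p: "\<And>e E. Q e E \<longleftrightarrow> sat e E p" unfolding arith_def by blast
  have "case_nat X (\<lambda>_. {}) = (\<lambda>_. {})(0 := X)" for X :: "nat set"
    by (intro ext) (auto split: nat.split)
  then show ?thesis
    unfolding Pi11_set_def using Q[of "(\<lambda>_. 0)(0 := _)" "\<lambda>_. {}"] p by auto
qed

abbreviation cons_code :: "nat \<Rightarrow> nat \<Rightarrow> nat" where
  "cons_code x c \<equiv> Suc (prod_encode (x, c))"

lemma list_decode_eq_Nil: "list_decode c = [] \<longleftrightarrow> c = 0"
  by (metis list_decode.simps(1) list_encode.simps(1) list_decode_inverse)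

lemma list_decode_eq_Cons: "list_decode c = x # xs \<longleftrightarrow> (\<exists>d. c = cons_code x d \<and> list_decode d = xs)"
proof
  assume "list_decode c = x # xs"
  then have "c = cons_code x (list_encode xs)" by (metis list_decode_inverse list_encode.simps(2))
  then show "\<exists>d. c = cons_code x d \<and> list_decode d = xs" by auto
qed auto

text \<open>
  The graph of a function defined by primitive recursion is the least set closed under the recursion
  step. The values of \<open>b\<close> and \<open>s\<close> occur positively on the right, which therefore stays \<open>\<Pi>\<^sup>1\<^sub>1\<close> if
  these are: the set quantifier takes the place of a coding of finite sequences by numbers.
\<close>

lemma rec_option_eq_Some_iff:
  "rec_nat b (\<lambda>k r. case r of None \<Rightarrow> None | Some y \<Rightarrow> s k y) n = Some v \<longleftrightarrow>
    (\<forall>X. (\<exists>y. b = Some y \<and> prod_encode (0, y) \<notin> X) \<or>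
      (\<exists>k y y'. prod_encode (k, y) \<in> X \<and> s k y = Some y' \<and> prod_encode (Suc k, y') \<notin> X) \<or>
      prod_encode (n, v) \<in> X)" (is "?f n = _ \<longleftrightarrow> (\<forall>X. ?R X)")
proof
  assume v: "?f n = Some v"
  show "\<forall>X. ?R X"
  proof (intro allI, rule ccontr)
    fix X assume nR: "\<not> ?R X"
    have "?f k = Some y \<Longrightarrow> prod_encode (k, y) \<in> X" for k y
      by (induction k arbitrary: y) (use nR in \<open>auto split: option.splits\<close>)
    then show False using v nR by blast
  qed
next
  assume "\<forall>X. ?R X"
  from this[rule_format, of "{prod_encode (k, y) |k y. ?f k = Some y}"]
  show "?f n = Some v" by auto
qed

text \<open>
  Of the schemes only primitive recursion needs a set quantifier; the others are explicit
  definitions with number quantifiers.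
\<close>

lemma Pi11_recf_eval: "Pi11 (\<lambda>e E. recf_eval r (list_decode (e 0)) = Some (e (Suc 0)))"
proof (induction r)
  case Zero
  have *: "recf_eval Zero (list_decode c) = Some v \<longleftrightarrow> v = 0" for c v by auto
  show ?case unfolding * by (intro Pi11_intros)
next
  case Succ
  have *: "recf_eval Succ (list_decode c) = Some v \<longleftrightarrow> (\<exists>x d. c = cons_code x d \<and> v = Suc x)" for c v
    by (cases "list_decode c") (auto simp: list_decode_eq_Nil list_decode_eq_Cons)
  show ?case unfolding * by (intro Pi11_intros)
next
  case (Proj i)
  have "Pi11 (\<lambda>e E. i < length (list_decode (e 0)) \<and> list_decode (e 0) ! i = e (Suc 0))"
  proof (induction i)
    case 0
    have *: "0 < length (list_decode c) \<and> list_decode c ! 0 = v \<longleftrightarrow> (\<exists>d. c = cons_code v d)" for c v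
      by (cases "list_decode c") (auto simp: list_decode_eq_Nil list_decode_eq_Cons)
    show ?case unfolding * by (intro Pi11_intros)
  next
    case (Suc i)
    have *: "Suc i < length (list_decode c) \<and> list_decode c ! Suc i = v \<longleftrightarrow>
      (\<exists>x d. c = cons_code x d \<and> (i < length (list_decode d) \<and> list_decode d ! i = v))" for c v
      by (cases "list_decode c") (auto simp: list_decode_eq_Nil list_decode_eq_Cons)
    show ?case
      unfolding * by (intro Pi11_relation[OF Suc] Pi11_intros)
  qed
  moreover have *: "recf_eval (Proj i) xs = Some v \<longleftrightarrow> i < length xs \<and> xs ! i = v" for xs v by auto
  ultimately show ?case unfolding * by blast
next
  case (Comp f gs)
  have gs: "Pi11 (\<lambda>e E. those (map (\<lambda>g. recf_eval g (list_decode (e 0))) gs) = Some (list_decode (e (Suc 0))))"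
    using Comp.IH(2)
  proof (induction gs)
    case Nil
    have *: "those (map (\<lambda>g. recf_eval g (list_decode c)) []) = Some (list_decode d) \<longleftrightarrow> d = 0" for c d
      using list_decode_eq_Nil[of d] by auto
    show ?case unfolding * by (intro Pi11_intros)
  next
    case (Cons g gs)
    have g: "Pi11 (\<lambda>e E. recf_eval g (list_decode (e 0)) = Some (e (Suc 0)))"
      using Cons.prems by simp
    have gs: "Pi11 (\<lambda>e E. those (map (\<lambda>g. recf_eval g (list_decode (e 0))) gs) = Some (list_decode (e (Suc 0))))"
      using Cons by simp
    have *: "those (map (\<lambda>g. recf_eval g (list_decode c)) (g # gs)) = Some (list_decode d) \<longleftrightarrow>
      (\<exists>y d'. d = cons_code y d' \<and> recf_eval g (list_decode c) = Some y \<and>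
        those (map (\<lambda>g. recf_eval g (list_decode c)) gs) = Some (list_decode d'))" for c d
      by (cases "list_decode d")
        (auto simp: list_decode_eq_Nil list_decode_eq_Cons split: option.splits)
    show ?case unfolding * by (intro Pi11_relation[OF g] Pi11_relation[OF gs] Pi11_intros)
  qed
  have *: "recf_eval (Comp f gs) (list_decode c) = Some v \<longleftrightarrow>
    (\<exists>d. those (map (\<lambda>g. recf_eval g (list_decode c)) gs) = Some (list_decode d) \<and>
      recf_eval f (list_decode d) = Some v)" for c v
    by (auto split: option.splits) (metis list_encode_inverse)
  show ?case unfolding * by (intro Pi11_relation[OF Comp.IH(1)] Pi11_relation[OF gs] Pi11_intros)
next
  case (PrimRec f g)
  have *: "recf_eval (PrimRec f g) (list_decode c) = Some v \<longleftrightarrow> (\<exists>n d. c = cons_code n d \<and>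
    (\<forall>X. (\<exists>y. recf_eval f (list_decode d) = Some y \<and> prod_encode (0, y) \<notin> X) \<or>
      (\<exists>k y y'. prod_encode (k, y) \<in> X \<and>
        recf_eval g (list_decode (cons_code k (cons_code y d))) = Some y' \<and>
        prod_encode (Suc k, y') \<notin> X) \<or>
      prod_encode (n, v) \<in> X))" for c v
    unfolding list_decode.simps prod_encode_inverse prod.case rec_option_eq_Some_iff[symmetric]
    by (cases "list_decode c") (auto simp: list_decode_eq_Nil list_decode_eq_Cons)
  show ?case unfolding * by (intro Pi11_relation[OF PrimRec(1)] Pi11_relation[OF PrimRec(2)] Pi11_intros)
next
  case (Mu f)
  have *: "recf_eval (Mu f) (list_decode c) = Some n \<longleftrightarrow>
    recf_eval f (list_decode (cons_code n c)) = Some 0 \<and>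
    (\<forall>m. \<not> m < n \<or> (\<exists>y. recf_eval f (list_decode (cons_code m c)) = Some (Suc y)))" for c n
  proof -
    have "(LEAST k. recf_eval f (k # list_decode c) = Some 0) = n"
      if "recf_eval f (n # list_decode c) = Some 0"
        "\<forall>m<n. \<exists>y. recf_eval f (m # list_decode c) = Some (Suc y)" for n
      by (rule Least_equality) (use that in \<open>force simp: not_less[symmetric]\<close>)+
    then show ?thesis by auto
  qed
  show ?case unfolding * by (intro Pi11_relation[OF Mu] Pi11_intros)
qed

text \<open>
  Reversal as the run of the usual loop with an accumulator. Prefixing an element to a code is
  arithmetical, so positions will be coded in reverse, and only the argument of Arthur's strategy
  has to be turned around.
\<close>

lemma Pi11_rev: "Pi11 (\<lambda>e E. list_decode (e (Suc 0)) = rev (list_decode (e 0)))"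
proof -
  have *: "list_decode d = rev (list_decode c) \<longleftrightarrow>
    (\<forall>X. prod_encode (c, 0) \<notin> X \<or>
      (\<exists>x u w. prod_encode (cons_code x u, w) \<in> X \<and> prod_encode (u, cons_code x w) \<notin> X) \<or>
      prod_encode (0, d) \<in> X)" (is "_ \<longleftrightarrow> (\<forall>X. ?R X)") for c d
  proof
    assume d: "list_decode d = rev (list_decode c)"
    show "\<forall>X. ?R X"
    proof (intro allI, rule ccontr)
      fix X assume nR: "\<not> ?R X"
      have "prod_encode (list_encode xs, w) \<in> X \<Longrightarrow>
        prod_encode (0, list_encode (rev xs @ list_decode w)) \<in> X" for xs w
      proof (induction xs arbitrary: w)
        case (Cons x xs)
        then have "prod_encode (list_encode xs, cons_code x w) \<in> X" using nR by auto
        from Cons.IH[OF this] show ?case by simp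
      qed simp
      from this[of "list_decode c" 0] show False using nR by (simp flip: d)
    qed
  next
    assume "\<forall>X. ?R X"
    from this[rule_format, of "{prod_encode (u, w) |u w. rev (list_decode u) @ list_decode w = rev (list_decode c)}"]
    show "list_decode d = rev (list_decode c)" by auto
  qed
  show ?thesis unfolding * by (intro Pi11_intros)
qed

section \<open>Functions below a filter are hyperarithmetic\<close>

text \<open>
  Arthur can be driven to the answer \<open>m\<close> from \<open>\<sigma>\<close>, in the game tree in which each query branches
  over a set in \<open>\<F>\<close>.
\<close>

inductive forces_output :: "(nat list \<Rightarrow> nat option) \<Rightarrow> nat set set \<Rightarrow> nat \<Rightarrow> nat list \<Rightarrow> bool"
  for \<phi> \<F> m where
  answer: "\<phi> \<sigma> = Some (prod_encode (1, m)) \<Longrightarrow> forces_output \<phi> \<F> m \<sigma>"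
| query: "\<phi> \<sigma> = Some (prod_encode (0, 0)) \<Longrightarrow> A \<in> \<F> \<Longrightarrow> (\<forall>x\<in>A. forces_output \<phi> \<F> m (\<sigma> @ [x])) \<Longrightarrow>
    forces_output \<phi> \<F> m \<sigma>"

text \<open>
  At a query the two sets of replies have a common element, because \<open>\<F>\<close> is a filter.
\<close>

lemma forces_output_unique:
  assumes F: "set_filter \<F>"
  shows "forces_output \<phi> \<F> m \<sigma> \<Longrightarrow> forces_output \<phi> \<F> m' \<sigma> \<Longrightarrow> m = m'"
proof (induction rule: forces_output.induct)
  case (answer \<sigma>)
  from answer(2,1) show ?case by (cases rule: forces_output.cases) auto
next
  case (query \<sigma> A)
  from query.prems show ?case
  proof (cases rule: forces_output.cases)
    case (query B)
    with \<open>A \<in> \<F>\<close> F have "A \<inter> B \<in> \<F>" "{} \<notin> \<F>" by (auto simp: set_filter_def upper_set_def)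
    then obtain x where "x \<in> A" "x \<in> B" by (metis disjoint_iff)
    then show ?thesis using query query.IH \<open>\<forall>x\<in>A. _\<close> by blast
  qed (use query in auto)
qed

text \<open>
  Otherwise Merlin, with the secret set \<open>{f n}\<close>, can always reply so that the next position does
  not force \<open>f n\<close> either: the set \<open>\<eta> A \<sigma>\<close> lies in \<open>\<F>\<close> and so cannot consist of forcing replies only.
  The team does not win the resulting play.
\<close>

lemma winning_strategy_forces_output:
  assumes win: "winning_strategy (seq_of_fun f) (seq_of_upper_set \<F>) \<phi> \<eta>"
  shows "forces_output \<phi> \<F> (f n) [n]"
proof (rule ccontr)
  assume not_forced: "\<not> forces_output \<phi> \<F> (f n) [n]"
  define A where "A = {f n}"
  define reply where "reply \<sigma> = (SOME x. x \<in> \<eta> A \<sigma> \<and> \<not> forces_output \<phi> \<F> (f n) (\<sigma> @ [x]))" for \<sigma>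
  \<comment> \<open>Where the moves of the team are illegal the reply is arbitrary.\<close>
  define play where "play = rec_nat [n] (\<lambda>_ \<sigma>. \<sigma> @ [reply \<sigma>])"
  define x where "x k = last (play k)" for k
  have play_Suc: "play (Suc k) = play k @ [reply (play k)]" and play_0: "play 0 = [n]" for k
    by (simp_all add: play_def)
  have hist: "history x k = play k" for k
    by (induction k) (simp_all add: history_def x_def play_0 play_Suc)
  have x_Suc: "x (Suc k) = reply (play k)" for k by (simp add: x_def play_Suc)
  have reply: "reply \<sigma> \<in> \<eta> A \<sigma> \<and> \<not> forces_output \<phi> \<F> (f n) (\<sigma> @ [reply \<sigma>])"
    if legal: "legal_query (seq_of_upper_set \<F>) \<phi> \<eta> A \<sigma>" and "\<not> forces_output \<phi> \<F> (f n) \<sigma>" for \<sigma>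
  proof -
    have "\<phi> \<sigma> = Some (prod_encode (0, 0))" "\<eta> A \<sigma> \<in> \<F>"
      using legal by (auto simp: legal_query_def seq_of_upper_set_def split: if_splits)
    then have "\<exists>x. x \<in> \<eta> A \<sigma> \<and> \<not> forces_output \<phi> \<F> (f n) (\<sigma> @ [x])"
      using forces_output.query that(2) by blast
    then show ?thesis unfolding reply_def by (rule someI_ex)
  qed
  have "seq_of_fun f (x 0) = Some {A. f n \<in> A} \<and> A \<in> {A. f n \<in> A}"
    by (simp add: seq_of_fun_def x_def play_0 A_def)
  from win[unfolded winning_strategy_def, rule_format, of x "{A. f n \<in> A}" A, OF this]
  obtain k where legal: "\<And>j. j < k \<Longrightarrow> legal_query (seq_of_upper_set \<F>) \<phi> \<eta> A (play j)"
    and end_of_play: "correct_output \<phi> A (play k) \<or>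
      legal_query (seq_of_upper_set \<F>) \<phi> \<eta> A (play k) \<and> reply (play k) \<notin> \<eta> A (play k)"
    unfolding hist x_Suc by blast
  have "j \<le> k \<Longrightarrow> \<not> forces_output \<phi> \<F> (f n) (play j)" for j
    by (induction j) (use not_forced legal reply in \<open>auto simp: play_0 play_Suc\<close>)
  then have "\<not> forces_output \<phi> \<F> (f n) (play k)" by simp
  moreover from this have "\<not> correct_output \<phi> A (play k)"
    by (auto simp: correct_output_def A_def simp del: One_nat_def intro: forces_output.answer)
  ultimately show False using end_of_play reply by blast
qed

text \<open>
  The inductive definition in its impredicative form, for sets \<open>Y\<close> of codes of reversed positions.
  Upward closure turns the choice of a subset of \<open>{x. cons_code x s \<in> Y}\<close> in \<open>\<F>\<close> into membership of
  this set itself, so that \<open>\<F>\<close> occurs positively and without a quantifier over its elements.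
\<close>

lemma forces_output_iff_least_fixed_point:
  assumes up: "\<And>A B. A \<in> \<F> \<Longrightarrow> A \<subseteq> B \<Longrightarrow> B \<in> \<F>"
  shows "forces_output \<phi> \<F> m \<sigma> \<longleftrightarrow>
    (\<forall>Y. (\<exists>s. s \<notin> Y \<and> (\<phi> (rev (list_decode s)) = Some (prod_encode (1, m)) \<or>
          \<phi> (rev (list_decode s)) = Some (prod_encode (0, 0)) \<and> {x. cons_code x s \<in> Y} \<in> \<F>)) \<or>
      list_encode (rev \<sigma>) \<in> Y)" (is "_ \<longleftrightarrow> (\<forall>Y. ?open Y \<or> _ \<in> Y)")
proof
  assume \<sigma>: "forces_output \<phi> \<F> m \<sigma>"
  show "\<forall>Y. ?open Y \<or> list_encode (rev \<sigma>) \<in> Y"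
  proof (intro allI, rule ccontr)
    fix Y assume "\<not> (?open Y \<or> list_encode (rev \<sigma>) \<in> Y)"
    then have closed: "\<not> ?open Y" and "list_encode (rev \<sigma>) \<notin> Y" by blast+
    have "forces_output \<phi> \<F> m \<sigma> \<Longrightarrow> list_encode (rev \<sigma>) \<in> Y" for \<sigma>
    proof (induction rule: forces_output.induct)
      case (answer \<sigma>)
      then show ?case using closed by (metis list_encode_inverse rev_rev_ident)
    next
      case (query \<sigma> A)
      then have "A \<subseteq> {x. cons_code x (list_encode (rev \<sigma>)) \<in> Y}" by auto
      then have "{x. cons_code x (list_encode (rev \<sigma>)) \<in> Y} \<in> \<F>" using up query by blast
      then show ?case using closed query(1) by (metis list_encode_inverse rev_rev_ident)
    qed
    then show False using \<sigma> \<open>list_encode (rev \<sigma>) \<notin> Y\<close> by blast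
  qed
next
  let ?Y = "{s. forces_output \<phi> \<F> m (rev (list_decode s))}"
  assume "\<forall>Y. ?open Y \<or> list_encode (rev \<sigma>) \<in> Y"
  then have "?open ?Y \<or> list_encode (rev \<sigma>) \<in> ?Y" by (rule spec)
  moreover have "\<not> ?open ?Y"
    by (auto intro: forces_output.answer dest: forces_output.query)
  ultimately show "forces_output \<phi> \<F> m \<sigma>" by auto
qed

lemma Pi11_forces_output:
  assumes up: "\<And>A B. A \<in> \<F> \<Longrightarrow> A \<subseteq> B \<Longrightarrow> B \<in> \<F>" and F: "Pi11_family \<F>"
    and \<phi>: "partial_computable_on_strings \<phi>"
  shows "Pi11 (\<lambda>e E. forces_output \<phi> \<F> (e (Suc 0)) [e 0])"
proof -
  obtain r where r: "\<And>\<sigma>. \<phi> \<sigma> = recf_eval r [list_encode \<sigma>]"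
    using \<phi> unfolding partial_computable_on_strings_def by blast
  have "\<phi> (rev (list_decode s)) = Some v \<longleftrightarrow>
    (\<exists>t. list_decode t = rev (list_decode s) \<and> recf_eval r (list_decode (cons_code t 0)) = Some v)" for s v
    by (auto simp: r) (metis list_decode_inverse list_encode_inverse)+
  then have move: "Pi11 (\<lambda>e E. \<phi> (rev (list_decode (e 0))) = Some (e (Suc 0)))"
    by (simp only:) (intro Pi11_relation[OF Pi11_rev] Pi11_relation[OF Pi11_recf_eval] Pi11_intros)
  have *: "forces_output \<phi> \<F> m [n] \<longleftrightarrow>
    (\<forall>Y. (\<exists>s. s \<notin> Y \<and> (\<phi> (rev (list_decode s)) = Some (prod_encode (1, m)) \<or>
          \<phi> (rev (list_decode s)) = Some (prod_encode (0, 0)) \<and> {x. cons_code x s \<in> Y} \<in> \<F>)) \<or>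
      cons_code n 0 \<in> Y)" for m n
    using forces_output_iff_least_fixed_point[where \<F> = \<F>, OF up] by simp
  show ?thesis unfolding *
    by (intro Pi11_relation[OF move] Pi11_family_mem[OF F] arith_mem Pi11_intros)
qed

text \<open>
  The graph of \<open>f\<close> is \<open>\<Pi>\<^sup>1\<^sub>1\<close>, and \<open>m\<close> is not the value at \<open>n\<close> iff some \<open>m' \<noteq> m\<close>
  is.
\<close>

theorem hyperarithmetic_if_LT_le:
  assumes filter: "set_filter \<F>" and F: "Pi11_family \<F>"
    and le: "seq_of_fun f \<le>\<^sub>L\<^sub>T seq_of_upper_set \<F>"
  shows "hyperarithmetic f"
proof -
  obtain \<phi> \<eta> where \<phi>: "partial_computable_on_strings \<phi>"
    and win: "winning_strategy (seq_of_fun f) (seq_of_upper_set \<F>) \<phi> \<eta>"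
    using le unfolding LT_le_def by blast
  have graph: "forces_output \<phi> \<F> m [n] \<longleftrightarrow> m = f n" for m n
    using winning_strategy_forces_output[OF win] forces_output_unique[OF filter] by blast
  have "\<And>A B. A \<in> \<F> \<Longrightarrow> A \<subseteq> B \<Longrightarrow> B \<in> \<F>"
    using filter by (auto simp: set_filter_def upper_set_def)
  from Pi11_forces_output[OF this F \<phi>]
  have Pi: "Pi11 (\<lambda>e E. e (Suc 0) = f (e 0))" by (simp add: graph)
  let ?G = "{prod_encode (n, f n) |n. True}"
  have *: "z \<in> ?G \<longleftrightarrow> (\<exists>n m. z = prod_encode (n, m) \<and> m = f n)" for z by auto
  have "Pi11 (\<lambda>e E. e 0 \<in> ?G)"
    unfolding * by (intro Pi11_relation[OF Pi, where f = "\<lambda>e. e (Suc 0)"] Pi11_intros)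
  moreover have **: "z \<in> - ?G \<longleftrightarrow> (\<exists>n m m'. z = prod_encode (n, m) \<and> m \<noteq> m' \<and> m' = f n)" for z
    by (auto simp: prod_eq_iff) (metis prod_decode_inverse surj_pair)
  have "Pi11 (\<lambda>e E. e 0 \<in> - ?G)"
    unfolding ** by (intro Pi11_relation[OF Pi, where f = "\<lambda>e. e (Suc (Suc 0))"] Pi11_intros)
  ultimately show ?thesis
    unfolding hyperarithmetic_def hyperarithmetic_set_def Sigma11_set_def
    by (blast intro: Pi11_setI)
qed

section \<open>Closure properties of computable functions\<close>

text \<open>
  Total computable functions of the first \<open>n\<close> entries of an environment. As for \<^const>\<open>arith\<close>,
  bound variables are put in front, so that computability can be derived by applying rules along the
  structure of a definition. A predicate is decidable if its characteristic function, written with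
  \<^const>\<open>of_bool\<close>, is computable.
\<close>

definition computable :: "nat \<Rightarrow> ((nat \<Rightarrow> nat) \<Rightarrow> nat) \<Rightarrow> bool" where
  "computable n F \<longleftrightarrow> (\<exists>r. \<forall>e. recf_eval r (map e [0..<n]) = Some (F e))"

lemma those_map_Some: "those (map (\<lambda>x. Some (h x)) xs) = Some (map h xs)"
  by (induction xs) auto

lemma computable_var: "i < n \<Longrightarrow> computable n (\<lambda>e. e i)"
  unfolding computable_def by (intro exI[of _ "Proj i"]) simp

lemma computable_compose:
  assumes F: "computable k F" and G: "\<And>i. i < k \<Longrightarrow> computable n (G i)"
  shows "computable n (\<lambda>e. F (\<lambda>i. G i e))"
proof -
  obtain r where r: "\<And>e. recf_eval r (map e [0..<k]) = Some (F e)"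
    using F unfolding computable_def by blast
  obtain q where q: "\<And>i e. i < k \<Longrightarrow> recf_eval (q i) (map e [0..<n]) = Some (G i e)"
    using G unfolding computable_def by metis
  have "map (\<lambda>g. recf_eval g (map e [0..<n])) (map q [0..<k]) = map (\<lambda>i. Some (G i e)) [0..<k]" for e
    by (simp add: q)
  then have "recf_eval (Comp r (map q [0..<k])) (map e [0..<n]) = Some (F (\<lambda>i. G i e))" for e
    by (simp only: recf_eval.simps those_map_Some option.case r)
  then show ?thesis unfolding computable_def by blast
qed

lemma computable_rename: "computable m F \<Longrightarrow> (\<And>i. i < m \<Longrightarrow> r i < n) \<Longrightarrow> computable n (\<lambda>e. F (\<lambda>i. e (r i)))"
  by (rule computable_compose) (auto intro: computable_var)

lemma computable_rec:
  assumes t: "computable n t" and b: "computable n b"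
    and s: "computable (Suc (Suc n)) (\<lambda>e. s (e 0) (e (Suc 0)) (\<lambda>i. e (Suc (Suc i))))"
  shows "computable n (\<lambda>e. rec_nat (b e) (\<lambda>k r. s k r e) (t e))"
proof -
  obtain rt where rt: "\<And>e. recf_eval rt (map e [0..<n]) = Some (t e)"
    using t unfolding computable_def by blast
  obtain rb where rb: "\<And>e. recf_eval rb (map e [0..<n]) = Some (b e)"
    using b unfolding computable_def by blast
  obtain rs where rs: "\<And>e. recf_eval rs (map e [0..<Suc (Suc n)]) = Some (s (e 0) (e (Suc 0)) (\<lambda>i. e (Suc (Suc i))))"
    using s unfolding computable_def by blast
  have step: "recf_eval rs (k # y # map e [0..<n]) = Some (s k y e)" for k y e
  proof -
    have "map (case_nat k (case_nat y e)) [0..<Suc (Suc n)] = k # y # map e [0..<n]"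
      by (simp add: map_upt_Suc del: upt_Suc)
    then show ?thesis using rs[of "case_nat k (case_nat y e)"] by simp
  qed
  have rec: "recf_eval (PrimRec rb rs) (m # map e [0..<n]) = Some (rec_nat (b e) (\<lambda>k r. s k r e) m)" for m e
    by (induction m) (simp_all add: rb step)
  have "map (\<lambda>g. recf_eval g (map e [0..<n])) (rt # map Proj [0..<n]) =
      map Some (t e # map e [0..<n])" for e
    by (simp add: rt)
  then have "recf_eval (Comp (PrimRec rb rs) (rt # map Proj [0..<n])) (map e [0..<n]) =
      Some (rec_nat (b e) (\<lambda>k r. s k r e) (t e))" for e
    by (simp only: recf_eval.simps(4) those_map_Some[of "\<lambda>x. x", simplified] option.case rec list.map_ident)
  then show ?thesis unfolding computable_def by blast
qed

lemma computable_unary: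
  "computable 1 (\<lambda>e. F (e 0)) \<Longrightarrow> computable n t \<Longrightarrow> computable n (\<lambda>e. F (t e))"
  using computable_compose[of 1 "\<lambda>e. F (e 0)" n "\<lambda>_. t"] by simp

lemma computable_binary:
  assumes "computable 2 (\<lambda>e. F (e 0) (e (Suc 0)))" "computable n t" "computable n u"
  shows "computable n (\<lambda>e. F (t e) (u e))"
  using computable_compose[OF assms(1), of n "case_nat t (\<lambda>_. u)"] assms(2,3)
  by (simp split: nat.split)

lemma computable_ternary:
  assumes "computable 3 (\<lambda>e. F (e 0) (e (Suc 0)) (e (Suc (Suc 0))))"
    "computable n t" "computable n u" "computable n v"
  shows "computable n (\<lambda>e. F (t e) (u e) (v e))"
  using computable_compose[OF assms(1), of n "case_nat t (case_nat u (\<lambda>_. v))"] assms(2-4)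
  by (simp split: nat.split)

lemma computable_Suc: "computable n t \<Longrightarrow> computable n (\<lambda>e. Suc (t e))"
  by (rule computable_unary[where F = Suc]) (auto simp: computable_def intro: exI[of _ Succ])

lemma computable_const: "computable n (\<lambda>e. c)"
proof (induction c)
  case 0
  show ?case unfolding computable_def by (intro exI[of _ Zero]) simp
qed (rule computable_Suc)

lemma computable_plus: "computable n t \<Longrightarrow> computable n u \<Longrightarrow> computable n (\<lambda>e. t e + u e)"
proof -
  have "rec_nat b (\<lambda>k r. Suc r) a = a + b" for a b by (induction a) auto
  then show "computable n t \<Longrightarrow> computable n u \<Longrightarrow> computable n (\<lambda>e. t e + u e)"
    using computable_rec[of n t u "\<lambda>k r e. Suc r"] computable_Suc computable_var by simp
qed

lemma computable_sum:
  assumes t: "computable n t" and s: "computable (Suc n) (\<lambda>e. s (e 0) (\<lambda>i. e (Suc i)))"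
  shows "computable n (\<lambda>e. \<Sum>i<t e. s i e)"
proof -
  have "computable (Suc (Suc n)) (\<lambda>e. s (e 0) (\<lambda>i. e (Suc (Suc i))))"
    using computable_rename[OF s, of "case_nat 0 (\<lambda>i. Suc (Suc i))" "Suc (Suc n)"]
    by (simp split: nat.split)
  then have "computable n (\<lambda>e. rec_nat 0 (\<lambda>k r. r + s k e) (t e))"
    by (intro computable_rec t computable_const computable_plus computable_var) simp_all
  moreover have "rec_nat 0 (\<lambda>k r. r + s k e) m = (\<Sum>i<m. s i e)" for m e
    by (induction m) auto
  ultimately show ?thesis by simp
qed

lemma computable_times: "computable n t \<Longrightarrow> computable n u \<Longrightarrow> computable n (\<lambda>e. t e * u e)"
  using computable_sum[of n t "\<lambda>i. u"] computable_rename[of n u Suc "Suc n"] by simp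

lemma computable_diff: "computable n t \<Longrightarrow> computable n u \<Longrightarrow> computable n (\<lambda>e. t e - u e)"
proof -
  have pred: "computable n (\<lambda>e. t e - 1)" if "computable n t" for n t
  proof -
    have "rec_nat 0 (\<lambda>k r. k) a = a - 1" for a :: nat by (cases a) auto
    then show ?thesis
      using computable_rec[OF that computable_const[of n 0], of "\<lambda>k r e. k"] computable_var by simp
  qed
  have "rec_nat a (\<lambda>k r. r - 1) b = a - b" for a b :: nat by (induction b) auto
  then show "computable n t \<Longrightarrow> computable n u \<Longrightarrow> computable n (\<lambda>e. t e - u e)"
    using computable_rec[of n u t "\<lambda>k r e. r - 1"] pred[OF computable_var] by simp
qed

lemma computable_le: "computable n t \<Longrightarrow> computable n u \<Longrightarrow> computable n (\<lambda>e. of_bool (t e \<le> u e))"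
proof -
  have "of_bool (a \<le> b) = 1 - (a - b)" for a b :: nat by auto
  then show "computable n t \<Longrightarrow> computable n u \<Longrightarrow> computable n (\<lambda>e. of_bool (t e \<le> u e))"
    by (simp only:) (intro computable_diff computable_const)
qed

lemma computable_conj:
  "computable n (\<lambda>e. of_bool (P e)) \<Longrightarrow> computable n (\<lambda>e. of_bool (Q e)) \<Longrightarrow>
    computable n (\<lambda>e. of_bool (P e \<and> Q e))"
  unfolding of_bool_conj by (rule computable_times)

lemma computable_not:
  assumes "computable n (\<lambda>e. of_bool (P e))"
  shows "computable n (\<lambda>e. of_bool (\<not> P e))"
proof -
  have "of_bool (\<not> p) = 1 - (of_bool p :: nat)" for p by auto
  then show ?thesis using computable_diff[OF computable_const assms, of 1] by simp
qed

lemma computable_disj: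
  assumes "computable n (\<lambda>e. of_bool (P e))" "computable n (\<lambda>e. of_bool (Q e))"
  shows "computable n (\<lambda>e. of_bool (P e \<or> Q e))"
  using computable_not[OF computable_conj[OF assms[THEN computable_not]]] by simp

lemma computable_imp:
  assumes "computable n (\<lambda>e. of_bool (P e))" "computable n (\<lambda>e. of_bool (Q e))"
  shows "computable n (\<lambda>e. of_bool (P e \<longrightarrow> Q e))"
  using computable_not[OF computable_conj[OF assms(1) computable_not[OF assms(2)]]] by simp

lemma computable_iff:
  assumes "computable n (\<lambda>e. of_bool (P e))" "computable n (\<lambda>e. of_bool (Q e))"
  shows "computable n (\<lambda>e. of_bool (P e \<longleftrightarrow> Q e))"
  unfolding iff_conv_conj_imp by (intro computable_conj computable_imp assms)

lemma computable_less: "computable n t \<Longrightarrow> computable n u \<Longrightarrow> computable n (\<lambda>e. of_bool (t e < u e))"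
  unfolding less_eq_Suc_le by (intro computable_le computable_Suc)

lemma computable_eq: "computable n t \<Longrightarrow> computable n u \<Longrightarrow> computable n (\<lambda>e. of_bool ((t e :: nat) = u e))"
  unfolding order_eq_iff by (intro computable_conj computable_le)

lemma computable_if:
  assumes "computable n (\<lambda>e. of_bool (P e))" "computable n t" "computable n u"
  shows "computable n (\<lambda>e. if P e then t e else u e)"
proof -
  have "(if p then a else b) = of_bool p * a + of_bool (\<not> p) * b" for p and a b :: nat by simp
  then show ?thesis by (simp only:) (intro computable_plus computable_times computable_not assms)
qed

lemma computable_bounded_ex:
  assumes "computable n t" "computable (Suc n) (\<lambda>e. of_bool (P (e 0) (\<lambda>i. e (Suc i))))"
  shows "computable n (\<lambda>e. of_bool (\<exists>i<t e. P i e))"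
proof -
  have "(\<exists>i<m. P i e) \<longleftrightarrow> 0 < (\<Sum>i<m. of_bool (P i e) :: nat)" for m e
    by (induction m) (auto simp: less_Suc_eq)
  then show ?thesis by (simp only:) (intro computable_less computable_sum computable_const assms)
qed

lemma computable_bounded_all:
  assumes "computable n t" "computable (Suc n) (\<lambda>e. of_bool (P (e 0) (\<lambda>i. e (Suc i))))"
  shows "computable n (\<lambda>e. of_bool (\<forall>i<t e. P i e))"
  using computable_not[OF computable_bounded_ex[OF assms(1) computable_not[OF assms(2)]]] by simp

lemma triangle_sum: "triangle n = (\<Sum>i<n. Suc i)"
  by (induction n) auto

lemma computable_prod_encode:
  "computable n t \<Longrightarrow> computable n u \<Longrightarrow> computable n (\<lambda>e. prod_encode (t e, u e))"
  unfolding prod_encode_def prod.case triangle_sum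
  by (intro computable_plus computable_sum computable_Suc computable_var) simp_all

lemmas computable_intros = computable_prod_encode computable_bounded_all computable_bounded_ex
  computable_conj computable_disj computable_not computable_imp computable_iff computable_less computable_le computable_eq
  computable_if computable_sum computable_plus computable_times computable_diff computable_Suc
  computable_const computable_var

text \<open>
  Bounded sums express the search for the components of a pair, with no appeal to the recursion
  that defines \<^const>\<open>prod_decode\<close>.
\<close>

lemma prod_decode_sums:
  "fst (prod_decode z) = (\<Sum>a<Suc z. \<Sum>b<Suc z. of_bool (z = prod_encode (a, b)) * a)"
  "snd (prod_decode z) = (\<Sum>a<Suc z. \<Sum>b<Suc z. of_bool (z = prod_encode (a, b)) * b)"
proof -
  obtain a b where z: "z = prod_encode (a, b)" by (metis prod_decode_inverse surj_pair)
  have ab: "a < Suc z" "b < Suc z" by (simp_all add: z le_prod_encode_1 le_prod_encode_2 less_Suc_eq_le)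
  have sums: "(\<Sum>a'<Suc z. \<Sum>b'<Suc z. of_bool (z = prod_encode (a', b')) * h a' b') = h a b" for h :: "nat \<Rightarrow> nat \<Rightarrow> nat"
  proof -
    have "(\<Sum>b'<Suc z. of_bool (z = prod_encode (a', b')) * h a' b') =
      (\<Sum>b'<Suc z. if b' = b then of_bool (a' = a) * h a b else 0)" for a'
      by (intro sum.cong) (auto simp: z)
    also have "\<dots> a' = of_bool (a' = a) * h a b" for a'
      by (subst sum.delta) (use ab in simp_all)
    finally have "(\<Sum>a'<Suc z. \<Sum>b'<Suc z. of_bool (z = prod_encode (a', b')) * h a' b') =
      (\<Sum>a'<Suc z. if a' = a then h a b else 0)" by (intro sum.cong) auto
    also have "\<dots> = h a b" by (subst sum.delta) (use ab in simp_all)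
    finally show ?thesis .
  qed
  show "fst (prod_decode z) = (\<Sum>a<Suc z. \<Sum>b<Suc z. of_bool (z = prod_encode (a, b)) * a)"
    unfolding sums[of "\<lambda>a b. a"] by (simp add: z)
  show "snd (prod_decode z) = (\<Sum>a<Suc z. \<Sum>b<Suc z. of_bool (z = prod_encode (a, b)) * b)"
    unfolding sums[of "\<lambda>a b. b"] by (simp add: z)
qed

text \<open>
  List operations on the codes of \<^const>\<open>list_encode\<close>. The empty list, with code 0, behaves like a list of
  zeros, since \<open>prod_decode 0 = (0, 0)\<close>; thus every code \<open>s\<close> also denotes an environment
  \<open>code_nth s\<close> that is eventually 0.
\<close>

definition code_head :: "nat \<Rightarrow> nat" where "code_head c = fst (prod_decode (c - 1))"
definition code_tail :: "nat \<Rightarrow> nat" where "code_tail c = snd (prod_decode (c - 1))"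
definition code_nth :: "nat \<Rightarrow> nat \<Rightarrow> nat" where "code_nth c i = code_head ((code_tail ^^ i) c)"
definition code_length :: "nat \<Rightarrow> nat" where
  "code_length c = (\<Sum>i<c. of_bool ((code_tail ^^ i) c \<noteq> 0))"

lemma computable_code_head: "computable n t \<Longrightarrow> computable n (\<lambda>e. code_head (t e))"
  by (rule computable_unary[where F = code_head]) (unfold code_head_def prod_decode_sums, intro computable_intros, simp_all)

lemma computable_code_tail: "computable n t \<Longrightarrow> computable n (\<lambda>e. code_tail (t e))"
  by (rule computable_unary[where F = code_tail]) (unfold code_tail_def prod_decode_sums, intro computable_intros, simp_all)

lemma computable_code_drop:
  assumes "computable n t" "computable n u"
  shows "computable n (\<lambda>e. (code_tail ^^ u e) (t e))"
proof -
  have "(code_tail ^^ i) c = rec_nat c (\<lambda>k r. code_tail r) i" for i c by (induction i) auto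
  then show ?thesis
    by (simp only:) (intro computable_rec assms computable_code_tail computable_var, simp)
qed

lemma computable_code_nth:
  "computable n t \<Longrightarrow> computable n u \<Longrightarrow> computable n (\<lambda>e. code_nth (t e) (u e))"
  unfolding code_nth_def by (intro computable_code_head computable_code_drop)

lemma computable_code_length: "computable n t \<Longrightarrow> computable n (\<lambda>e. code_length (t e))"
  by (rule computable_unary[where F = code_length])
    (unfold code_length_def, intro computable_code_drop computable_intros, simp_all)

lemmas computable_code_intros = computable_code_head computable_code_tail computable_code_nth
  computable_code_length

lemma prod_decode_0: "prod_decode 0 = (0, 0)"
  using prod_encode_inverse[of "(0, 0)"] by (simp add: prod_encode_def)

lemma code_head_list_encode: "code_head (list_encode xs) = (case xs of [] \<Rightarrow> 0 | x # _ \<Rightarrow> x)"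
  by (cases xs) (simp_all add: code_head_def prod_decode_0)

lemma code_tail_list_encode: "code_tail (list_encode xs) = list_encode (tl xs)"
  by (cases xs) (simp_all add: code_tail_def prod_decode_0)

lemma code_drop_list_encode: "(code_tail ^^ i) (list_encode xs) = list_encode (drop i xs)"
  by (induction i) (simp_all add: code_tail_list_encode drop_Suc tl_drop)

lemma code_nth_list_encode: "code_nth (list_encode xs) i = (if i < length xs then xs ! i else 0)"
  unfolding code_nth_def code_drop_list_encode code_head_list_encode
  by (auto simp: Cons_nth_drop_Suc[symmetric])

lemma length_le_list_encode: "length xs \<le> list_encode xs"
  by (induction xs) (auto intro: order_trans le_prod_encode_2)

lemma code_length_list_encode: "code_length (list_encode xs) = length xs"
proof -
  have "list_encode ys \<noteq> 0 \<longleftrightarrow> ys \<noteq> []" for ys by (cases ys) auto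
  moreover have "(\<Sum>i<m. of_bool (i < l)) = min m l" for m l :: nat by (induction m) auto
  ultimately show ?thesis
    using length_le_list_encode[of xs] by (simp add: code_length_def code_drop_list_encode not_le)
qed

lemma code_nth_beyond: "c \<le> i \<Longrightarrow> code_nth c i = 0"
  using code_nth_list_encode[of "list_decode c" i] length_le_list_encode[of "list_decode c"] by simp

lemma prod_encode_mono: "a \<le> a' \<Longrightarrow> b \<le> b' \<Longrightarrow> prod_encode (a, b) \<le> prod_encode (a', b')"
  by (auto simp: prod_encode_def triangle_def intro!: add_mono div_le_mono mult_le_mono)

text \<open>
  This bounds the search for lists below a given list.
\<close>

lemma list_encode_mono: "list_all2 (\<le>) xs ys \<Longrightarrow> list_encode xs \<le> list_encode ys"
  by (induction rule: list_all2_induct) (auto intro: prod_encode_mono)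

section \<open>A tree normal form for \<open>\<Sigma>\<^sup>1\<^sub>1\<close> sets\<close>

instance arith_term :: countable by countable_datatype
instance arith_formula :: countable by countable_datatype

text \<open>
  One function \<open>G\<close> will carry both a set, on the indices \<open>oracle_index x\<close>, and a table of the truth
  values of formulas \<open>p\<close> at environments \<open>s\<close>, on the indices \<open>truth_index p s\<close>. The value 0 stands
  for membership and for truth.
\<close>

definition truth_index :: "arith_formula \<Rightarrow> nat \<Rightarrow> nat" where
  "truth_index p s = prod_encode (Suc (to_nat p), s)"

definition oracle_index :: "nat \<Rightarrow> nat" where
  "oracle_index x = prod_encode (0, x)"

text \<open>
  The clauses of the truth definition, for the subformulas of \<open>p\<close> and restricted to entries of
  \<open>G\<close> below \<open>k\<close>. A false universal formula has to provide a counterexample: its value is the successor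
  of one. This makes the condition local, since a universal quantifier over the numbers is compared
  with one instance at a time. Here \<open>s'\<close> stands for an update of \<open>s\<close> at \<open>i\<close>; the bound \<open>s + s'\<close> covers
  all arguments at which one of the two environments is not 0.
\<close>

primrec locally_correct :: "arith_formula \<Rightarrow> nat \<Rightarrow> (nat \<Rightarrow> nat) \<Rightarrow> bool" where
  "locally_correct (Eq t u) k G \<longleftrightarrow> (\<forall>s<k. truth_index (Eq t u) s < k \<longrightarrow>
     (G (truth_index (Eq t u) s) = 0 \<longleftrightarrow> term_val (code_nth s) t = term_val (code_nth s) u))"
| "locally_correct (Less t u) k G \<longleftrightarrow> (\<forall>s<k. truth_index (Less t u) s < k \<longrightarrow>
     (G (truth_index (Less t u) s) = 0 \<longleftrightarrow> term_val (code_nth s) t < term_val (code_nth s) u))"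
| "locally_correct (In t i) k G \<longleftrightarrow> (\<forall>s<k. truth_index (In t i) s < k \<longrightarrow>
     oracle_index (term_val (code_nth s) t) < k \<longrightarrow>
     (G (truth_index (In t i) s) = 0 \<longleftrightarrow> i = 0 \<and> G (oracle_index (term_val (code_nth s) t)) = 0))"
| "locally_correct (Neg p) k G \<longleftrightarrow> locally_correct p k G \<and>
     (\<forall>s<k. truth_index (Neg p) s < k \<longrightarrow> truth_index p s < k \<longrightarrow>
       (G (truth_index (Neg p) s) = 0 \<longleftrightarrow> \<not> G (truth_index p s) = 0))"
| "locally_correct (Conj p q) k G \<longleftrightarrow> locally_correct p k G \<and> locally_correct q k G \<and>
     (\<forall>s<k. truth_index (Conj p q) s < k \<longrightarrow> truth_index p s < k \<longrightarrow> truth_index q s < k \<longrightarrow>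
       (G (truth_index (Conj p q) s) = 0 \<longleftrightarrow> G (truth_index p s) = 0 \<and> G (truth_index q s) = 0))"
| "locally_correct (Forall i p) k G \<longleftrightarrow> locally_correct p k G \<and>
     (\<forall>s<k. truth_index (Forall i p) s < k \<longrightarrow> (\<forall>s'<k. truth_index p s' < k \<longrightarrow>
       (\<forall>j<s + s'. j = i \<or> code_nth s' j = code_nth s j) \<longrightarrow>
       (G (truth_index (Forall i p) s) = 0 \<longrightarrow> G (truth_index p s') = 0) \<and>
       (G (truth_index (Forall i p) s) = Suc (code_nth s' i) \<longrightarrow> \<not> G (truth_index p s') = 0)))"

lemma locally_correct_antimono: "locally_correct p k G \<Longrightarrow> l \<le> k \<Longrightarrow> locally_correct p l G"
  by (induction p) (simp_all only: locally_correct.simps, (meson less_le_trans)+)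

lemma locally_correct_local:
  assumes "\<And>i. i < k \<Longrightarrow> G i = H i"
  shows "locally_correct p k G = locally_correct p k H"
  by (induction p) (simp_all add: assms cong: imp_cong)

lemma computable_term_val:
  "computable n s \<Longrightarrow> computable n (\<lambda>e. term_val (code_nth (s e)) t)"
  by (induction t) (simp_all, (intro computable_code_intros computable_intros | assumption)+)

lemma computable_locally_correct:
  assumes "computable n k" "computable n c"
  shows "computable n (\<lambda>e. of_bool (locally_correct p (k e) (code_nth (c e))))"
proof (rule computable_binary[OF _ assms, where F = "\<lambda>k c. of_bool (locally_correct p k (code_nth c))"])
  show "computable 2 (\<lambda>e. of_bool (locally_correct p (e 0) (code_nth (e (Suc 0)))))"
    by (induction p; unfold locally_correct.simps truth_index_def oracle_index_def;
      (intro computable_term_val computable_code_intros computable_intros | assumption)+; simp)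
qed

lemma update_code:
  obtains s' where "code_nth s' = (code_nth s)(i := n)"
proof
  let ?xs = "map ((code_nth s)(i := n)) [0..<max (Suc i) s]"
  show "code_nth (list_encode ?xs) = (code_nth s)(i := n)"
    by (auto simp: fun_eq_iff code_nth_list_encode code_nth_beyond)
qed

text \<open>
  By induction on \<open>p\<close>, each entry being checked at a \<open>k\<close> beyond the indices involved.
\<close>

lemma locally_correct_sat:
  assumes "\<And>k. locally_correct p k G"
    and E: "\<And>i x. x \<in> E i \<longleftrightarrow> i = 0 \<and> G (oracle_index x) = 0"
  shows "G (truth_index p s) = 0 \<longleftrightarrow> sat (code_nth s) E p"
  using assms(1)
proof (induction p arbitrary: s)
  case (Eq t u)
  from Eq[of "Suc (s + truth_index (Eq t u) s)"] show ?case by simp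
next
  case (Less t u)
  from Less[of "Suc (s + truth_index (Less t u) s)"] show ?case by simp
next
  case (In t i)
  from In[of "Suc (s + truth_index (In t i) s + oracle_index (term_val (code_nth s) t))"]
  show ?case by (auto simp: E)
next
  case (Neg p)
  have "G (truth_index p s) = 0 \<longleftrightarrow> sat (code_nth s) E p"
    by (rule Neg.IH) (use Neg.prems in simp)
  with Neg.prems[of "Suc (s + truth_index (Neg p) s + truth_index p s)"] show ?case by auto
next
  case (Conj p q)
  have "G (truth_index p s) = 0 \<longleftrightarrow> sat (code_nth s) E p" "G (truth_index q s) = 0 \<longleftrightarrow> sat (code_nth s) E q"
    by (rule Conj.IH, use Conj.prems in simp)+
  with Conj.prems[of "Suc (s + truth_index (Conj p q) s + truth_index p s + truth_index q s)"]
  show ?case by auto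
next
  case (Forall i p)
  have IH: "G (truth_index p s') = 0 \<longleftrightarrow> sat (code_nth s') E p" for s'
    by (rule Forall.IH) (use Forall.prems in simp)
  have local: "(G (truth_index (Forall i p) s) = 0 \<longrightarrow> G (truth_index p s') = 0) \<and>
      (G (truth_index (Forall i p) s) = Suc n \<longrightarrow> \<not> G (truth_index p s') = 0)"
    if "code_nth s' = (code_nth s)(i := n)" for s' n
  proof -
    define k where "k = Suc (s + s' + truth_index (Forall i p) s + truth_index p s')"
    have "s < k" "s' < k" "truth_index (Forall i p) s < k" "truth_index p s' < k"
      by (simp_all add: k_def)
    with Forall.prems[of k] have "(\<forall>j<s + s'. j = i \<or> code_nth s' j = code_nth s j) \<longrightarrow>
      (G (truth_index (Forall i p) s) = 0 \<longrightarrow> G (truth_index p s') = 0) \<and>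
      (G (truth_index (Forall i p) s) = Suc (code_nth s' i) \<longrightarrow> \<not> G (truth_index p s') = 0)"
      unfolding locally_correct.simps by blast
    then show ?thesis by (simp add: that)
  qed
  show ?case
  proof (cases "G (truth_index (Forall i p) s)")
    case 0
    then show ?thesis using local IH by simp (metis update_code)
  next
    case (Suc n)
    then show ?thesis using local IH by simp (metis update_code)
  qed
qed

text \<open>
  The function that passes all local conditions for a given set \<open>X\<close>, with chosen
  counterexamples.
\<close>

definition truth_table :: "nat set \<Rightarrow> nat \<Rightarrow> nat" where
  "truth_table X c = (case prod_decode c of
     (0, x) \<Rightarrow> of_bool (x \<notin> X)
   | (Suc j, s) \<Rightarrow> let p = from_nat j; E = (\<lambda>_. {})(0 := X) in
       if sat (code_nth s) E p then 0
       else (case p of Forall i q \<Rightarrow> Suc (SOME n. \<not> sat ((code_nth s)(i := n)) E q) | _ \<Rightarrow> 1))"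

lemma truth_table_oracle_index: "truth_table X (oracle_index x) = 0 \<longleftrightarrow> x \<in> X"
  by (simp add: truth_table_def oracle_index_def)

lemma truth_table_truth_index:
  "truth_table X (truth_index p s) = 0 \<longleftrightarrow> sat (code_nth s) ((\<lambda>_. {})(0 := X)) p"
  by (auto simp: truth_table_def truth_index_def Let_def split: arith_formula.split)

lemma truth_table_witness:
  assumes "truth_table X (truth_index (Forall i p) s) = Suc n"
  shows "\<not> sat ((code_nth s)(i := n)) ((\<lambda>_. {})(0 := X)) p"
proof -
  let ?E = "(\<lambda>_. {})(0 := X)"
  have "\<not> sat (code_nth s) ?E (Forall i p)" using assms truth_table_truth_index by (metis nat.distinct(1))
  then have ex: "\<exists>n. \<not> sat ((code_nth s)(i := n)) ?E p" by simp
  have "n = (SOME n. \<not> sat ((code_nth s)(i := n)) ?E p)"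
    using assms by (simp add: truth_table_def truth_index_def Let_def split: if_splits)
  then show ?thesis using someI_ex[OF ex] by simp
qed

lemma locally_correct_truth_table: "locally_correct p k (truth_table X)"
proof (induction p)
  case (Forall i p)
  have upd: "code_nth s' = (code_nth s)(i := code_nth s' i)"
    if "\<forall>j<s + s'. j = i \<or> code_nth s' j = code_nth s j" for s s'
  proof
    fix j
    show "code_nth s' j = ((code_nth s)(i := code_nth s' i)) j"
      using that by (cases "j < s + s'") (auto simp: code_nth_beyond)
  qed
  have "\<not> sat (code_nth s') ((\<lambda>_. {})(0 := X)) p"
    if "\<forall>j<s + s'. j = i \<or> code_nth s' j = code_nth s j"
      "truth_table X (truth_index (Forall i p) s) = Suc (code_nth s' i)" for s s'
    using truth_table_witness[OF that(2)] upd[OF that(1)] by simp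
  moreover have "sat (code_nth s') ((\<lambda>_. {})(0 := X)) p"
    if "\<forall>j<s + s'. j = i \<or> code_nth s' j = code_nth s j"
      "sat (code_nth s) ((\<lambda>_. {})(0 := X)) (Forall i p)" for s s'
    using that(2) upd[OF that(1)] by (metis sat.simps(6))
  ultimately show ?case using Forall
    by (simp only: locally_correct.simps truth_table_truth_index) blast
qed (simp_all add: truth_table_truth_index truth_table_oracle_index)

text \<open>
  The function \<open>G\<close> consists of a witness for the set quantifier together with a truth table in which
  the formula defining the complement of \<open>S\<close> has the value false.
\<close>

theorem Sigma11_normal_form:
  assumes "Sigma11_set S"
  obtains C where "computable 3 (\<lambda>e. of_bool (C (e 0) (e (Suc 0)) (code_nth (e (Suc (Suc 0))))))"
    and "\<And>k x G H. (\<And>i. i < k \<Longrightarrow> G i = H i) \<Longrightarrow> C k x G = C k x H"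
    and "\<And>k l x G. C k x G \<Longrightarrow> l \<le> k \<Longrightarrow> C l x G"
    and "\<And>x. x \<in> S \<longleftrightarrow> (\<exists>G. \<forall>k. C k x G)"
proof -
  obtain p where p: "- S = {x. \<forall>X. sat ((\<lambda>_. 0)(0 := x)) ((\<lambda>_. {})(0 := X)) p}"
    using assms unfolding Sigma11_set_def Pi11_set_def by blast
  define root where "root x = truth_index p (Suc (prod_encode (x, 0)))" for x
  define C where "C k x G \<longleftrightarrow> locally_correct p k G \<and> (root x < k \<longrightarrow> \<not> G (root x) = 0)" for k x G
  have env: "code_nth (Suc (prod_encode (x, 0))) = (\<lambda>_. 0)(0 := x)" for x
    using code_nth_list_encode[of "[x]"] by (auto simp: fun_eq_iff)
  show thesis
  proof
    show "computable 3 (\<lambda>e. of_bool (C (e 0) (e (Suc 0)) (code_nth (e (Suc (Suc 0))))))"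
      unfolding C_def root_def truth_index_def
      by (intro computable_locally_correct computable_code_intros computable_intros) simp_all
    show "C k x G = C k x H" if "\<And>i. i < k \<Longrightarrow> G i = H i" for k x G H
      unfolding C_def using locally_correct_local[OF that] that by auto
    show "C l x G" if "C k x G" "l \<le> k" for k l x G
      using that unfolding C_def by (auto intro: locally_correct_antimono)
    show "x \<in> S \<longleftrightarrow> (\<exists>G. \<forall>k. C k x G)" for x
    proof
      assume "x \<in> S"
      then obtain X where X: "\<not> sat ((\<lambda>_. 0)(0 := x)) ((\<lambda>_. {})(0 := X)) p" using p by blast
      have "C k x (truth_table X)" for k
        unfolding C_def root_def
        using X by (simp add: locally_correct_truth_table truth_table_truth_index env)
      then show "\<exists>G. \<forall>k. C k x G" by blast
    next
      assume "\<exists>G. \<forall>k. C k x G"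
      then obtain G where G: "\<And>k. C k x G" by blast
      then have "\<not> G (root x) = 0" unfolding C_def by (meson lessI)
      moreover have "\<And>k. locally_correct p k G" using G unfolding C_def by blast
      ultimately have "\<not> sat (code_nth (Suc (prod_encode (x, 0)))) ((\<lambda>_. {})(0 := {x. G (oracle_index x) = 0})) p"
        by (subst locally_correct_sat[of p G, symmetric]) (auto simp: root_def split: if_splits)
      then have "\<not> sat ((\<lambda>_. 0)(0 := x)) ((\<lambda>_. {})(0 := {x. G (oracle_index x) = 0})) p"
        unfolding env .
      then show "x \<in> S" using p by blast
    qed
  qed
qed

section \<open>Hyperarithmetic functions are below free filters\<close>

text \<open>
  Koenig's lemma: the prefixes of the functions \<open>a k\<close> form an infinite tree with finite
  branching. The prefixes of \<open>g\<close> are chosen one by one such that infinitely many \<open>a k\<close> extend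
  them.
\<close>

lemma finitely_branching_compactness:
  fixes a :: "nat \<Rightarrow> nat \<Rightarrow> nat"
  assumes bound: "\<And>k i. i < k \<Longrightarrow> a k i \<le> h i"
  obtains g where "\<And>l. \<exists>k\<ge>l. \<forall>i<l. a k i = g i"
proof -
  define P where "P l xs \<longleftrightarrow> length xs = l \<and> infinite {k. \<forall>i<l. a k i = xs ! i}" for l xs
  have "\<exists>xs. \<forall>l. P l (xs l) \<and> (\<exists>v. xs (Suc l) = xs l @ [v])"
  proof (rule dependent_nat_choice)
    show "\<exists>xs. P 0 xs" by (simp add: P_def)
    fix xs l assume "P l xs"
    then have len: "length xs = l" and inf: "infinite ({k. \<forall>i<l. a k i = xs ! i} - {..l})"
      by (simp_all add: P_def)
    let ?K = "{k. \<forall>i<l. a k i = xs ! i} - {..l}"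
    have "finite ((\<lambda>k. a k l) ` ?K)"
      by (rule finite_subset[of _ "{..h l}"]) (auto intro: bound)
    from pigeonhole_infinite[OF inf this] obtain k where "infinite {k' \<in> ?K. a k' l = a k l}" by blast
    moreover have "{k' \<in> ?K. a k' l = a k l} \<subseteq> {k'. \<forall>i<Suc l. a k' i = (xs @ [a k l]) ! i}"
      by (auto simp: less_Suc_eq nth_append len)
    ultimately have "P (Suc l) (xs @ [a k l])"
      unfolding P_def using len infinite_super by auto
    then show "\<exists>ys. P (Suc l) ys \<and> (\<exists>v. ys = xs @ [v])" by blast
  qed
  then obtain xs where xs: "\<And>l. P l (xs l)" "\<And>l. \<exists>v. xs (Suc l) = xs l @ [v]" by blast
  define g where "g i = xs (Suc i) ! i" for i
  have len: "length (xs l) = l" for l using xs(1) by (simp add: P_def)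
  have g: "i < l \<Longrightarrow> xs l ! i = g i" for l i
  proof (induction l)
    case (Suc l)
    then show ?case
      using xs(2)[of l] len[of l] by (cases "i = l") (auto simp: g_def nth_append)
  qed simp
  show thesis
  proof
    fix l
    have "infinite {k. \<forall>i<l. a k i = g i}" using xs(1)[of l] g by (auto simp: P_def cong: conj_cong)
    then obtain k where "k > l" "\<forall>i<l. a k i = g i"
      unfolding finite_nat_set_iff_bounded_le by (auto simp: not_le)
    then show "\<exists>k\<ge>l. \<forall>i<l. a k i = g i" using less_imp_le by blast
  qed
qed

text \<open>
  The code \<open>c\<close> is that of a history: its head is the argument \<open>n\<close>, and its tail consists of the
  replies so far. A candidate value has an approximation \<open>d\<close> below the replies. By monotonicity of
  \<^const>\<open>list_encode\<close>, the code of such a \<open>d\<close> is at most \<open>c\<close>, so the search is bounded.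
\<close>

definition candidate :: "(nat \<Rightarrow> nat \<Rightarrow> (nat \<Rightarrow> nat) \<Rightarrow> bool) \<Rightarrow> nat \<Rightarrow> nat \<Rightarrow> bool" where
  "candidate C c m \<longleftrightarrow> (\<exists>d<Suc c.
     (\<forall>i<code_length (code_tail c). code_nth d i \<le> code_nth (code_tail c) i) \<and>
     C (code_length (code_tail c)) (prod_encode (code_head c, m)) (code_nth d))"

definition unique_candidate :: "(nat \<Rightarrow> nat \<Rightarrow> (nat \<Rightarrow> nat) \<Rightarrow> bool) \<Rightarrow> nat \<Rightarrow> nat \<Rightarrow> bool" where
  "unique_candidate C c m \<longleftrightarrow> candidate C c m \<and>
     (\<forall>m'<Suc (code_head (code_tail c)). candidate C c m' \<longrightarrow> m' = m)"

text \<open>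
  The query is \<open>0 = prod_encode (0, 0)\<close>. The first move is always a query, because its reply bounds the
  values to be considered. The sum has at most one nonzero term and is a computable way of picking the
  unique candidate.
\<close>

definition arthur_move :: "(nat \<Rightarrow> nat \<Rightarrow> (nat \<Rightarrow> nat) \<Rightarrow> bool) \<Rightarrow> nat \<Rightarrow> nat" where
  "arthur_move C c = (let b = Suc (code_head (code_tail c)) in
     if 0 < code_length (code_tail c) \<and> (\<exists>m<b. unique_candidate C c m)
     then prod_encode (1, \<Sum>m<b. of_bool (unique_candidate C c m) * m)
     else 0)"

lemma computable_arthur_move:
  assumes C: "computable 3 (\<lambda>e. of_bool (C (e 0) (e (Suc 0)) (code_nth (e (Suc (Suc 0))))))"
  shows "computable 1 (\<lambda>e. arthur_move C (e 0))"
proof -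
  note C' = computable_ternary[where F = "\<lambda>k x d. of_bool (C k x (code_nth d))", OF C]
  have "computable 2 (\<lambda>e. of_bool (candidate C (e 0) (e (Suc 0))))"
    unfolding candidate_def
    by (intro computable_bounded_ex computable_conj C' computable_code_intros computable_intros) simp_all
  note cand = computable_binary[where F = "\<lambda>c m. of_bool (candidate C c m)", OF this]
  have "computable 2 (\<lambda>e. of_bool (unique_candidate C (e 0) (e (Suc 0))))"
    unfolding unique_candidate_def
    by (intro computable_conj computable_bounded_all computable_imp cand computable_code_intros computable_intros) simp_all
  note uniq = computable_binary[where F = "\<lambda>c m. of_bool (unique_candidate C c m)", OF this]
  show ?thesis
    unfolding arthur_move_def Let_def
    by (intro computable_if computable_conj computable_bounded_ex computable_sum computable_times
        computable_prod_encode uniq computable_code_intros computable_intros) simp_all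
qed

lemma arthur_move_cases:
  obtains (answer) m where "arthur_move C c = prod_encode (1, m)" "m \<le> code_head (code_tail c)"
      "0 < code_length (code_tail c)" "unique_candidate C c m"
    | (query) "arthur_move C c = prod_encode (0, 0)"
      "0 < code_length (code_tail c) \<Longrightarrow> \<not> (\<exists>m\<le>code_head (code_tail c). unique_candidate C c m)"
proof (cases "0 < code_length (code_tail c) \<and> (\<exists>m<Suc (code_head (code_tail c)). unique_candidate C c m)")
  case True
  then obtain m where m: "m < Suc (code_head (code_tail c))" "unique_candidate C c m" by blast
  have uniq: "unique_candidate C c m' \<longleftrightarrow> m' = m" if "m' < Suc (code_head (code_tail c))" for m'
    using m that unfolding unique_candidate_def by blast
  have "(\<Sum>m'<Suc (code_head (code_tail c)). of_bool (unique_candidate C c m') * m') =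
      (\<Sum>m'<Suc (code_head (code_tail c)). if m' = m then m else 0)"
    by (rule sum.cong) (use uniq in auto)
  also have "\<dots> = m" by (subst sum.delta) (use m(1) in simp_all)
  finally have "arthur_move C c = prod_encode (1, m)" using True by (simp add: arthur_move_def Let_def)
  then show thesis using answer m True by (simp add: less_Suc_eq_le)
next
  case False
  then have "arthur_move C c = prod_encode (0, 0)"
    by (simp only: arthur_move_def Let_def if_False) (simp add: prod_encode_def)
  then show thesis using query False by (auto simp: less_Suc_eq_le)
qed

lemma candidate_list_encode:
  "candidate C (list_encode (n # hs)) m \<longleftrightarrow> (\<exists>d<Suc (list_encode (n # hs)).
     (\<forall>i<length hs. code_nth d i \<le> hs ! i) \<and> C (length hs) (prod_encode (n, m)) (code_nth d))"
  unfolding candidate_def code_tail_list_encode code_head_list_encode list.sel list.case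
    code_length_list_encode code_nth_list_encode by simp

lemma candidateI:
  assumes local: "\<And>k x G H. (\<And>i. i < k \<Longrightarrow> G i = H i) \<Longrightarrow> C k x G = C k x H"
    and C: "C (length hs) (prod_encode (n, m)) G" and le: "\<And>i. i < length hs \<Longrightarrow> G i \<le> hs ! i"
  shows "candidate C (list_encode (n # hs)) m"
proof -
  let ?d = "list_encode (map G [0..<length hs])"
  have "?d \<le> list_encode hs"
    by (rule list_encode_mono) (use le in \<open>auto simp: list_all2_conv_all_nth\<close>)
  also have "\<dots> \<le> list_encode (n # hs)" by (simp add: le_SucI le_prod_encode_2)
  finally have "?d < Suc (list_encode (n # hs))" by simp
  moreover have "C (length hs) (prod_encode (n, m)) (code_nth ?d)"
    using C local[of "length hs" G "code_nth ?d"] by (simp add: code_nth_list_encode)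
  ultimately show ?thesis
    unfolding candidate_list_encode using le by (intro exI[of _ ?d]) (simp add: code_nth_list_encode)
qed

text \<open>
  Each number is missed by some set in \<open>\<F>\<close>, and finitely many such sets can be intersected.
\<close>

lemma filter_cofinite:
  assumes filter: "set_filter \<F>" and free: "\<Inter>\<F> = {}"
  shows "{b..} \<in> \<F>"
proof (induction b)
  case 0
  then show ?case using filter by (auto simp: set_filter_def upper_set_def)
next
  case (Suc b)
  obtain A where A: "A \<in> \<F>" "b \<notin> A" using free by blast
  have "A \<inter> {b..} \<in> \<F>" using filter A(1) Suc by (simp add: set_filter_def)
  moreover have "A \<inter> {b..} \<subseteq> {Suc b..}" using A(2) by (auto simp: Suc_le_eq le_less)
  ultimately show ?case using filter unfolding set_filter_def upper_set_def by blast
qed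

text \<open>
  Nimue keeps the replies above \<open>f n\<close> and above a branch \<open>G n\<close> witnessing this value. As long as
  Merlin obeys, \<open>f n\<close> stays a candidate, so an answer is correct. If no answer were ever given,
  there would be wrong candidates at all stages. They are bounded by the first reply and their
  approximations by the later ones, so compactness gives one wrong value with an infinite branch.
\<close>

theorem LT_le_if_hyperarithmetic:
  assumes cofinite: "\<And>b. {b..} \<in> \<F>" and f: "hyperarithmetic f"
  shows "seq_of_fun f \<le>\<^sub>L\<^sub>T seq_of_upper_set \<F>"
proof -
  have "Sigma11_set {prod_encode (n, f n) |n. True}"
    using f by (simp add: hyperarithmetic_def hyperarithmetic_set_def)
  then obtain C where
    C: "computable 3 (\<lambda>e. of_bool (C (e 0) (e (Suc 0)) (code_nth (e (Suc (Suc 0))))))"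
    and local: "\<And>k x G H. (\<And>i. i < k \<Longrightarrow> G i = H i) \<Longrightarrow> C k x G = C k x H"
    and antimono: "\<And>k l x G. C k x G \<Longrightarrow> l \<le> k \<Longrightarrow> C l x G"
    and graph: "\<And>x. x \<in> {prod_encode (n, f n) |n. True} \<longleftrightarrow> (\<exists>G. \<forall>k. C k x G)"
    by (rule Sigma11_normal_form) blast
  have graph': "m = f n \<longleftrightarrow> (\<exists>G. \<forall>k. C k (prod_encode (n, m)) G)" for n m
    using graph[of "prod_encode (n, m)"] by auto
  then have "\<forall>n. \<exists>G. \<forall>k. C k (prod_encode (n, f n)) G" by blast
  then obtain G where G: "\<And>n k. C k (prod_encode (n, f n)) (G n)" by metis
  define \<phi> where "\<phi> \<sigma> = Some (arthur_move C (list_encode \<sigma>))" for \<sigma>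
  define \<eta> where "\<eta> A \<sigma> = {max (f (hd \<sigma>)) (G (hd \<sigma>) (length \<sigma> - 1))..}" for A :: "nat set" and \<sigma>
  obtain r where "\<And>e. recf_eval r (map e [0..<1]) = Some (arthur_move C (e 0))"
    using computable_arthur_move[OF C] unfolding computable_def by blast
  from this[of "\<lambda>_. list_encode _"] have "recf_eval r [list_encode \<sigma>] = \<phi> \<sigma>" for \<sigma>
    by (simp add: \<phi>_def)
  then have "partial_computable_on_strings \<phi>"
    unfolding partial_computable_on_strings_def by (intro exI[of _ r]) simp
  moreover have "winning_strategy (seq_of_fun f) (seq_of_upper_set \<F>) \<phi> \<eta>"
    unfolding winning_strategy_def
  proof (intro allI impI, elim conjE)
    fix A and x :: "nat \<Rightarrow> nat" and \<U> assume "seq_of_fun f (x 0) = Some \<U>" "A \<in> \<U>"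
    then have fA: "f (x 0) \<in> A" by (auto simp: seq_of_fun_def)
    define h where "h i = x (Suc i)" for i
    define c where "c k = list_encode (x 0 # map h [0..<k])" for k
    have hist: "history x k = x 0 # map h [0..<k]" for k
      unfolding history_def h_def by (simp add: map_upt_Suc o_def del: upt_Suc)
    have \<phi>: "\<phi> (history x k) = Some (arthur_move C (c k))" for k by (simp add: \<phi>_def c_def hist)
    have \<eta>: "\<eta> A (history x k) = {max (f (x 0)) (G (x 0) k)..}" for k by (simp add: \<eta>_def hist)
    have tail: "code_tail (c k) = list_encode (map h [0..<k])" for k
      unfolding c_def code_tail_list_encode by simp
    have len: "code_length (code_tail (c k)) = k" for k by (simp add: tail code_length_list_encode)
    have head: "code_head (code_tail (c k)) = h 0" if "0 < k" for k
      unfolding tail code_head_list_encode using that by (simp add: upt_conv_Cons)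
    have legal: "legal_query (seq_of_upper_set \<F>) \<phi> \<eta> A (history x k)"
      if "arthur_move C (c k) = prod_encode (0, 0)" for k
      using cofinite that by (simp add: legal_query_def \<phi> \<eta> seq_of_upper_set_def)
    have true_candidate: "f (x 0) \<le> h 0" "candidate C (c k) (f (x 0))"
      if "0 < k" "\<forall>i<k. h i \<in> \<eta> A (history x i)" for k
    proof -
      have "h i \<ge> f (x 0)" "h i \<ge> G (x 0) i" if "i < k" for i
        using that \<open>\<forall>i<k. _\<close> by (auto simp: \<eta>)
      note le = this
      show "f (x 0) \<le> h 0" using le \<open>0 < k\<close> by simp
      show "candidate C (c k) (f (x 0))"
        unfolding c_def
      proof (rule candidateI[where G = "G (x 0)"])
        show "C k' y G' = C k' y H'" if "\<And>i. i < k' \<Longrightarrow> G' i = H' i" for k' y G' H'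
          by (rule local[OF that])
      qed (use le G in simp_all)
    qed
    have "\<exists>k. arthur_move C (c k) \<noteq> prod_encode (0, 0) \<or> h k \<notin> \<eta> A (history x k)"
    proof (rule ccontr)
      assume "\<not> ?thesis"
      then have query: "\<And>k. arthur_move C (c k) = prod_encode (0, 0)"
        and reply: "\<And>k. h k \<in> \<eta> A (history x k)" by blast+
      have "\<exists>m d. 0 < k \<longrightarrow> m \<le> h 0 \<and> m \<noteq> f (x 0) \<and> (\<forall>i<k. code_nth d i \<le> h i) \<and>
        C k (prod_encode (x 0, m)) (code_nth d)" for k
      proof (cases "0 < k")
        case True
        have "\<not> (\<exists>m\<le>code_head (code_tail (c k)). unique_candidate C (c k) m)"
          by (cases rule: arthur_move_cases[of C "c k"]) (use query[of k] len[of k] True in auto)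
        then obtain m where "m \<le> h 0" "m \<noteq> f (x 0)" "candidate C (c k) m"
          using true_candidate[OF True] reply head[OF True]
          by (auto simp: unique_candidate_def less_Suc_eq_le)
        then show ?thesis unfolding c_def candidate_list_encode by auto
      qed simp
      then obtain m d where md: "\<And>k. 0 < k \<Longrightarrow> m k \<le> h 0 \<and> m k \<noteq> f (x 0) \<and>
        (\<forall>i<k. code_nth (d k) i \<le> h i) \<and> C k (prod_encode (x 0, m k)) (code_nth (d k))" by metis
      \<comment> \<open>Compactness is applied to the approximations with the candidate value put in front, so that it
        stabilises as well.\<close>
      obtain g where g: "\<And>l. \<exists>k\<ge>l. \<forall>i<l. case_nat (m k) (code_nth (d k)) i = g i"
      proof (rule finitely_branching_compactness)
        show "case_nat (m k) (code_nth (d k)) i \<le> case_nat (h 0) h i" if "i < k" for k i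
          using md[of k] that by (auto split: nat.split)
      qed blast
      have "g 0 \<noteq> f (x 0)" using g[of 1] md by force
      moreover have "C l (prod_encode (x 0, g 0)) (\<lambda>i. g (Suc i))" for l
      proof -
        obtain k where k: "k \<ge> Suc l" "\<forall>i<Suc l. case_nat (m k) (code_nth (d k)) i = g i" using g by blast
        then have "C l (prod_encode (x 0, m k)) (code_nth (d k))" using md[of k] antimono by auto
        moreover have "m k = g 0" "\<And>i. i < l \<Longrightarrow> code_nth (d k) i = g (Suc i)"
          using k(2) by (force, metis Suc_less_eq old.nat.simps(5))
        ultimately show ?thesis using local[of l "code_nth (d k)" "\<lambda>i. g (Suc i)"] by simp
      qed
      ultimately show False using graph' by blast
    qed
    then obtain k where k: "arthur_move C (c k) \<noteq> prod_encode (0, 0) \<or> h k \<notin> \<eta> A (history x k)"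
      and before: "\<And>i. i < k \<Longrightarrow> arthur_move C (c i) = prod_encode (0, 0) \<and> h i \<in> \<eta> A (history x i)"
      by (subst (asm) exists_least_iff) blast
    show "\<exists>n. (\<forall>m<n. legal_query (seq_of_upper_set \<F>) \<phi> \<eta> A (history x m)) \<and>
      (correct_output \<phi> A (history x n) \<or>
       legal_query (seq_of_upper_set \<F>) \<phi> \<eta> A (history x n) \<and> x (Suc n) \<notin> \<eta> A (history x n))"
    proof (intro exI[of _ k] conjI allI impI)
      show "legal_query (seq_of_upper_set \<F>) \<phi> \<eta> A (history x i)" if "i < k" for i
        using legal before that by blast
      show "correct_output \<phi> A (history x k) \<or>
        legal_query (seq_of_upper_set \<F>) \<phi> \<eta> A (history x k) \<and> x (Suc k) \<notin> \<eta> A (history x k)"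
      proof (cases rule: arthur_move_cases[of C "c k"])
        case (answer m)
        then have "0 < k" by (simp add: len)
        with before have "f (x 0) \<le> h 0" "candidate C (c k) (f (x 0))" by (auto intro: true_candidate)
        then have "f (x 0) = m"
          using answer(4) head[OF \<open>0 < k\<close>] by (auto simp: unique_candidate_def less_Suc_eq_le)
        then show ?thesis using answer(1) fA by (auto simp: correct_output_def \<phi>)
      next
        case query
        then show ?thesis using k legal by (auto simp: h_def)
      qed
    qed
  qed
  ultimately show ?thesis unfolding LT_le_def by blast
qed

theorem theoremF:
  fixes \<F> :: "nat set set" and f :: "nat \<Rightarrow> nat"
  assumes "set_filter \<F>"
    and "\<not> principal_filter \<F>"
    and "\<Inter>\<F> = {}"
    and "Delta11_family \<F>"
  shows "seq_of_fun f \<le>\<^sub>L\<^sub>T seq_of_upper_set \<F> \<longleftrightarrow> hyperarithmetic f"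
proof
  assume "seq_of_fun f \<le>\<^sub>L\<^sub>T seq_of_upper_set \<F>"
  then show "hyperarithmetic f"
    using hyperarithmetic_if_LT_le assms(1,4) unfolding Delta11_family_def by blast
next
  assume "hyperarithmetic f"
  then show "seq_of_fun f \<le>\<^sub>L\<^sub>T seq_of_upper_set \<F>"
    using LT_le_if_hyperarithmetic filter_cofinite assms(1,3) by blast
qed

end
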